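(* Let $\Omega=(\Omega_n)_{n\ge0}$ be a sequence of nonnegative numbers with $\Omega_0\neq0$ and let $W_n=\sum_{k=0}^n\Omega_k$, $n=0,1,2,\dots$ Then, for every sequence $f=(f(n))_{n=0}^\infty\subset\mathbb C$: (i) If $0<p\le1$, $$\|f\|_{d(\Omega,p)'}=\sup_{n\ge0}W_n^{-1/p}\sum_{k=0}^nf^*(k).$$ (ii) If $1<p<\infty$ and $\Omega\notin\ell^1$, $$C_1\|f\|_{d(\Omega,p)'}\le\Big(\sum_{n=0}^\infty\big(A_df^*(n)\big)^{p'}\widetilde\Omega_n\Big)^{1/p'}\le C_2\|f\|_{d(\Omega,p)'},$$ where $\widetilde\Omega_0=W_0^{1-p'}$, $\widetilde\Omega_n=(n+1)^{p'}\big(W_{n-1}^{1-p'}-W_n^{1-p'}\big)$ for $n\ge1$, and the constants $C_1,C_2>0$ depend only on $p$. (iii) If $0<p<\infty$, $$\|f\|_{d^\infty(\Omega,p)'}=\sum_{n=0}^\infty f^*(n)W_n^{-1/p}=\|f\|_{d(W^{-1/p},1)}.$$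
   Context: $\frac1p+\frac1{p'}=1$. For a complex sequence $f=(f(n))_{n\ge0}$, $f^*$ is its nonincreasing rearrangement, $f^*(n)=\inf\{s>0:\#\{k:|f(k)|>s\}\le n\}$. For $0<p<\infty$, $\|f\|_{d(\Omega,p)}=\big(\sum_{n=0}^\infty f^*(n)^p\,\Omega_n\big)^{1/p}$ and $\|f\|_{d^\infty(\Omega,p)}=\sup_{n\ge0}W_n^{1/p}f^*(n)$, and $d(\Omega,p)$, $d^\infty(\Omega,p)$ are the sets of sequences where these are finite. For $E=d(\Omega,p)$ or $E=d^\infty(\Omega,p)$ the associate norm is $\|f\|_{E'}=\sup\{\sum_n|f(n)g(n)|:\|g\|_E\le1\}\in[0,\infty]$. $A_d$ is the discrete Hardy operator $A_df(n)=\frac1{n+1}\sum_{k=0}^nf(k)$. $W^{-1/p}$ denotes the sequence $(W_n^{-1/p})_n$. *)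

theory Defs
  imports "HOL-Analysis.Analysis"
begin

text \<open>All (quasi-)norms take values in \<^typ>\<open>ennreal\<close>: an arbitrary complex sequence may
  be unbounded, in which case its rearrangement is identically \<open>\<infinity>\<close>, and it may have
  infinite norm. As usual in measure theory, \<open>\<infinity> * 0 = 0\<close>.\<close>

text \<open>Powers of extended nonnegative reals; only used for exponents \<open>a > 0\<close>, where \<open>\<infinity>\<close> has power \<open>\<infinity>\<close>.\<close>

definition ennreal_powr :: "ennreal \<Rightarrow> real \<Rightarrow> ennreal"  (infixr "epowr" 80) where
  "x epowr a = (if x = \<infinity> then \<infinity> else ennreal (enn2real x powr a))"

text \<open>The infimum is taken in \<^typ>\<open>ennreal\<close>, so that the infimum of the empty set is \<open>\<infinity>\<close>;
  finiteness is explicit because the cardinality of an infinite set is \<open>0\<close>.\<close>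

definition rearr :: "(nat \<Rightarrow> complex) \<Rightarrow> nat \<Rightarrow> ennreal" where
  "rearr f n = Inf (ennreal ` {s. 0 < s \<and> finite {k. s < cmod (f k)} \<and> card {k. s < cmod (f k)} \<le> n})"

definition psum :: "(nat \<Rightarrow> real) \<Rightarrow> nat \<Rightarrow> real" where
  "psum \<Omega> n = (\<Sum>k\<le>n. \<Omega> k)"

definition d_norm :: "(nat \<Rightarrow> real) \<Rightarrow> real \<Rightarrow> (nat \<Rightarrow> complex) \<Rightarrow> ennreal" where
  "d_norm \<Omega> p f = (\<Sum>n. (rearr f n epowr p) * ennreal (\<Omega> n)) epowr (1 / p)"

definition dinf_norm :: "(nat \<Rightarrow> real) \<Rightarrow> real \<Rightarrow> (nat \<Rightarrow> complex) \<Rightarrow> ennreal" where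
  "dinf_norm \<Omega> p f = (SUP n. ennreal (psum \<Omega> n powr (1 / p)) * rearr f n)"

definition assoc_norm :: "((nat \<Rightarrow> complex) \<Rightarrow> ennreal) \<Rightarrow> (nat \<Rightarrow> complex) \<Rightarrow> ennreal" where
  "assoc_norm N f = (SUP g\<in>{g. N g \<le> 1}. \<Sum>n. ennreal (cmod (f n * g n)))"

text \<open>The discrete Hardy operator, on \<^typ>\<open>ennreal\<close>-valued sequences since it is applied to rearrangements.\<close>

definition hardy_d :: "(nat \<Rightarrow> ennreal) \<Rightarrow> nat \<Rightarrow> ennreal" where
  "hardy_d h n = (\<Sum>k\<le>n. h k) / of_nat (n + 1)"

text \<open>The dual weight; \<open>q\<close> stands for the conjugate exponent of \<open>p\<close>.\<close>

definition dual_weight :: "(nat \<Rightarrow> real) \<Rightarrow> real \<Rightarrow> nat \<Rightarrow> real" where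
  "dual_weight \<Omega> q n =
     (if n = 0 then psum \<Omega> 0 powr (1 - q)
      else real (n + 1) powr q * (psum \<Omega> (n - 1) powr (1 - q) - psum \<Omega> n powr (1 - q)))"

end

theory Submission
  imports Defs
begin

text \<open>Since the counting measure is resonant (any finite decreasing sequence can be placed on indices
  where \<open>|f|\<close> nearly attains its rearrangement), the associate norms are suprema of
  \<open>\<Sum> f*(n) b(n)\<close> over decreasing \<open>b\<close> in the unit ball.

  For \<open>p \<le> 1\<close> summation by parts reduces to convexity of \<open>t \<mapsto> t powr (1 / p)\<close>.
  For \<open>p > 1\<close> put \<open>F = psum f*\<close>, \<open>W = psum \<Omega>\<close>; the dual sum is comparable to the Abel sum
  \<open>E = \<Sum> (F(n)^q - F(n-1)^q) W(n)^(1-q)\<close>, because \<open>F(n+1) \<le> 2 F(n)\<close> and \<open>W \<rightarrow> \<infinity>\<close>.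
  The upper bound is a Young inequality \<open>\<Sum> f* b \<le> E + \<Sum> b^p \<Omega>\<close>; the lower bound tests with the
  least decreasing majorant of the pointwise optimiser \<open>(F / W)^(q-1)\<close>.\<close>

section \<open>Rearrangements and associate norms\<close>

text \<open>Associate norms see only decreasing test sequences, and this shapes the case
  \<open>p > 1\<close>: the quotient \<open>F / W\<close> need not decrease, so the pointwise
  optimiser is inadmissible, and the plateaus of its majorant carry extra mass that the Abel sum
  must still control. One part of the mass of a plateau is charged to the growth of
  \<open>F^q\<close>, the other to the decay of \<open>W^(1-q)\<close>. These appear in the two
  forms of \<open>E\<close> that summation by parts relates. Adding both forms gives the potential
  \<open>2 * E(n) - F(n)^q * W(n)^(1-q)\<close>, which explains the factor 2 in the constant.

  The other obstacle is an index shift. By parts, \<open>E\<close> is a boundary term plus the sum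
  of \<open>F(n-1)^q * (W(n-1)^(1-q) - W(n)^(1-q))\<close>, while the dual weight pairs the same
  differences with \<open>F(n)^q\<close>. Doubling bounds the dual sum by \<open>E\<close>. In the
  other direction monotonicity of \<open>F\<close> handles the shift, but the boundary term
  survives, and the divergence of \<open>W\<close> removes it.\<close>

lemma ennreal_powr_mono: "x epowr a \<le> y epowr a" if "x \<le> y" "0 \<le> a"
proof (cases "y = top")
  case False
  then have "x \<noteq> top" using that by (auto simp: top_unique)
  then show ?thesis
    using False that unfolding ennreal_powr_def
    by (auto intro!: ennreal_leI powr_mono2 enn2real_mono simp: less_top)
qed (simp add: ennreal_powr_def)

lemma ennreal_powr_ennreal: "ennreal r epowr a = ennreal (r powr a)" if "0 \<le> r"
  using that by (simp add: ennreal_powr_def)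

lemma ennreal_powr_le_one_iff:
  assumes "0 < a"
  shows "x epowr a \<le> 1 \<longleftrightarrow> x \<le> 1"
proof (cases x)
  case (real r)
  have "r powr a \<le> 1 \<longleftrightarrow> r \<le> 1"
  proof (cases "r \<le> 1")
    case True
    then show ?thesis using assms real powr_mono2[of a r 1] by simp
  next
    case False
    then show ?thesis using assms powr_less_mono2[of a 1 r] by (simp add: not_le)
  qed
  then show ?thesis using real by (simp add: ennreal_powr_ennreal)
qed (simp add: ennreal_powr_def)

lemma ennreal_suminf_le:
  assumes "\<And>n. 0 \<le> u n" "\<And>n. (\<Sum>i<n. u i) \<le> C"
  shows "(\<Sum>n. ennreal (u n)) \<le> ennreal C"
  unfolding suminf_eq_SUP
  by (intro SUP_least) (use assms in \<open>auto intro!: ennreal_leI\<close>)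

lemma sum_le_of_ennreal_suminf_le:
  assumes "\<And>n. 0 \<le> u n" "(\<Sum>n. ennreal (u n)) \<le> ennreal C" "0 \<le> C"
  shows "(\<Sum>i\<le>n. u i) \<le> C"
proof -
  have "ennreal (\<Sum>i\<le>n. u i) = (\<Sum>i\<le>n. ennreal (u i))"
    using assms by simp
  also have "\<dots> \<le> (\<Sum>n. ennreal (u n))" by (intro sum_le_suminf) auto
  finally show ?thesis using assms ennreal_le_iff by (metis order_trans)
qed

section \<open>The rearrangement inequality of Hardy and Littlewood\<close>

lemma rearr_antimono: "m \<le> n \<Longrightarrow> rearr f n \<le> rearr f m"
  unfolding rearr_def by (intro Inf_superset_mono image_mono) auto

text \<open>A level \<open>s < t\<close> is exceeded on all of \<open>A\<close>, which is one index
  too many for it to be admissible at \<open>card A - 1\<close>.\<close>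

lemma le_rearr:
  assumes "finite A" "A \<noteq> {}" "\<And>k. k \<in> A \<Longrightarrow> t \<le> cmod (f k)"
  shows "ennreal t \<le> rearr f (card A - 1)"
  unfolding rearr_def
proof (rule Inf_greatest, clarify)
  fix s :: real
  assume s: "0 < s" "finite {k. s < cmod (f k)}" "card {k. s < cmod (f k)} \<le> card A - 1"
  show "ennreal t \<le> ennreal s"
  proof (rule ccontr)
    assume "\<not> ennreal t \<le> ennreal s"
    then have "s < t" using s by (meson ennreal_leI not_le)
    then have "A \<subseteq> {k. s < cmod (f k)}" using assms(3) by force
    then have "card A \<le> card A - 1" using card_mono s(2,3) by (meson order_trans)
    then show False using assms(1,2) card_gt_0_iff[of A] by simp
  qed
qed

lemma rearr_real:
  assumes "rearr f 0 \<noteq> top"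
  obtains a where "\<And>n. rearr f n = ennreal (a n)" "antimono a" "\<And>n. 0 \<le> a n"
proof
  have fin: "rearr f n \<noteq> top" for n
    using assms rearr_antimono[of 0 n f] by (auto simp: top_unique)
  show "rearr f n = ennreal (enn2real (rearr f n))" for n
    using fin by (simp add: less_top)
  show "antimono (\<lambda>n. enn2real (rearr f n))"
    using fin by (intro antimonoI enn2real_mono rearr_antimono) (auto simp: less_top)
qed simp

text \<open>Peel off the smallest entry: all of \<open>A\<close> dominates it, so it lies below the
  last rearranged value of the sum.\<close>

lemma sum_le_sum_rearr:
  assumes f: "\<And>n. rearr f n = ennreal (a n)" and a: "\<And>n. 0 \<le> a n" and "finite A"
  shows "(\<Sum>k\<in>A. cmod (f k)) \<le> (\<Sum>i<card A. a i)"
  using \<open>finite A\<close>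
proof (induction "card A" arbitrary: A)
  case (Suc n)
  then have "finite A" "A \<noteq> {}" by auto
  then obtain k where k: "k \<in> A" "\<And>j. j \<in> A \<Longrightarrow> cmod (f k) \<le> cmod (f j)"
    using ex_min_if_finite[of "(\<lambda>k. cmod (f k)) ` A"] by (auto simp: not_less)
  have "ennreal (cmod (f k)) \<le> ennreal (a n)"
    using le_rearr[of A "cmod (f k)" f] \<open>finite A\<close> \<open>A \<noteq> {}\<close> k(2) Suc.hyps(2)[symmetric] f by simp
  then have "cmod (f k) \<le> a n" using a by (simp add: ennreal_le_iff)
  moreover have "(\<Sum>j\<in>A - {k}. cmod (f j)) \<le> (\<Sum>i<n. a i)"
    using Suc.hyps(1)[of "A - {k}"] Suc.hyps(2)[symmetric] k \<open>finite A\<close> by simp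
  ultimately show ?case
    using k \<open>finite A\<close> Suc.hyps(2)[symmetric] by (simp add: sum.remove)
qed simp

text \<open>Subtracting the smallest value of \<open>|g|\<close> on \<open>A\<close> makes the induction a summation by parts.\<close>

lemma sum_mult_le_sum_rearr:
  assumes f: "\<And>n. rearr f n = ennreal (a n)" and a: "\<And>n. 0 \<le> a n"
    and g: "\<And>n. rearr g n = ennreal (b n)" and b: "\<And>n. 0 \<le> b n"
    and "finite A" "\<And>k. k \<in> A \<Longrightarrow> t \<le> cmod (g k)"
  shows "(\<Sum>k\<in>A. cmod (f k) * (cmod (g k) - t)) \<le> (\<Sum>i<card A. a i * (b i - t))"
  using \<open>finite A\<close> assms(6)
proof (induction "card A" arbitrary: A t)
  case (Suc n)
  then have "finite A" "A \<noteq> {}" by auto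
  then obtain k where k: "k \<in> A" "\<And>j. j \<in> A \<Longrightarrow> cmod (g k) \<le> cmod (g j)"
    using ex_min_if_finite[of "(\<lambda>k. cmod (g k)) ` A"] by (auto simp: not_less)
  define s where "s = cmod (g k)"
  have "t \<le> s" using Suc.prems k unfolding s_def by auto
  have "ennreal s \<le> ennreal (b n)"
    using le_rearr[of A s g] \<open>finite A\<close> \<open>A \<noteq> {}\<close> k(2) Suc.hyps(2)[symmetric] g s_def by simp
  then have sb: "s \<le> b n" using b by (simp add: ennreal_le_iff)
  have "(\<Sum>j\<in>A. cmod (f j) * (cmod (g j) - t)) =
      (\<Sum>j\<in>A. cmod (f j) * (cmod (g j) - s)) + (s - t) * (\<Sum>j\<in>A. cmod (f j))"
    by (simp add: sum_distrib_left sum.distrib[symmetric] algebra_simps)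
  also have "(\<Sum>j\<in>A. cmod (f j) * (cmod (g j) - s)) = (\<Sum>j\<in>A - {k}. cmod (f j) * (cmod (g j) - s))"
    using k \<open>finite A\<close> by (simp add: sum.remove s_def)
  also have "\<dots> \<le> (\<Sum>i<n. a i * (b i - s))"
    using Suc.hyps(1)[of "A - {k}" s] Suc.hyps(2)[symmetric] k \<open>finite A\<close> s_def by simp
  also have "\<dots> \<le> (\<Sum>i<Suc n. a i * (b i - s))"
    using sb a by simp
  also have "(s - t) * (\<Sum>j\<in>A. cmod (f j)) \<le> (s - t) * (\<Sum>i<Suc n. a i)"
    using sum_le_sum_rearr[OF f a \<open>finite A\<close>] Suc.hyps(2) \<open>t \<le> s\<close> by (intro mult_left_mono) auto
  also have "(\<Sum>i<Suc n. a i * (b i - s)) + (s - t) * (\<Sum>i<Suc n. a i) = (\<Sum>i<Suc n. a i * (b i - t))"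
    unfolding sum_distrib_left sum.distrib[symmetric] by (intro sum.cong) (auto simp: algebra_simps)
  finally show ?case using Suc.hyps(2) by simp
qed simp

text \<open>Rearranging both factors can only increase the pairing. The hypothesis on
  \<open>N\<close> also demands finite rearrangements on the unit ball, so that all later estimates
  concern real sequences.\<close>

lemma assoc_norm_le:
  assumes f: "\<And>n. rearr f n = ennreal (a n)" and a: "\<And>n. 0 \<le> a n"
    and N: "\<And>g. N g \<le> 1 \<Longrightarrow>
      \<exists>b. (\<forall>n. rearr g n = ennreal (b n)) \<and> (\<forall>n. 0 \<le> b n) \<and> (\<forall>n. (\<Sum>i\<le>n. a i * b i) \<le> C)"
  shows "assoc_norm N f \<le> ennreal C"
  unfolding assoc_norm_def
proof (rule SUP_least)
  fix g assume "g \<in> {g. N g \<le> 1}"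
  then obtain b where b: "\<And>n. rearr g n = ennreal (b n)" "\<And>n. 0 \<le> b n"
    and le: "\<And>n. (\<Sum>i\<le>n. a i * b i) \<le> C"
    using N by blast
  show "(\<Sum>n. ennreal (cmod (f n * g n))) \<le> ennreal C"
    unfolding norm_mult
  proof (rule ennreal_suminf_le)
    fix n
    have "(\<Sum>i<n. cmod (f i) * cmod (g i)) \<le> (\<Sum>i<n. a i * b i)"
      using sum_mult_le_sum_rearr[OF f a b, of "{..<n}" 0] by simp
    also have "\<dots> \<le> (\<Sum>i\<le>n. a i * b i)" using a b by (intro sum_mono2) auto
    finally show "(\<Sum>i<n. cmod (f i) * cmod (g i)) \<le> C" using le[of n] by linarith
  qed simp
qed

section \<open>Resonance: lower bounds for associate norms\<close>

lemma exists_inj_above_rearr: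
  assumes "\<And>i. c i \<le> 0 \<or> ennreal (c i) < rearr f i"
  shows "\<exists>\<kappa>. inj_on \<kappa> {..<n} \<and> (\<forall>i<n. c i \<le> cmod (f (\<kappa> i)))"
proof (induction n)
  case (Suc n)
  then obtain \<kappa> where \<kappa>: "inj_on \<kappa> {..<n}" "\<forall>i<n. c i \<le> cmod (f (\<kappa> i))" by blast
  have "\<exists>k. k \<notin> \<kappa> ` {..<n} \<and> c n \<le> cmod (f k)"
  proof (rule ccontr)
    assume none: "\<not> ?thesis"
    then have sub: "{k. c n < cmod (f k)} \<subseteq> \<kappa> ` {..<n}"
      by force
    then have fin: "finite {k. c n < cmod (f k)}" by (rule finite_subset) simp
    have card: "card {k. c n < cmod (f k)} \<le> n"
      using card_mono[OF _ sub] card_image_le[of "{..<n}" \<kappa>] by simp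
    obtain k where "k \<notin> \<kappa> ` {..<n}" using ex_new_if_finite[of "\<kappa> ` {..<n}"] by auto
    then have "cmod (f k) < c n" using none by force
    then have pos: "0 < c n" using norm_ge_zero[of "f k"] by linarith
    then have "rearr f n \<le> ennreal (c n)"
      unfolding rearr_def using fin card by (intro Inf_lower) auto
    then show False using assms[of n] pos by auto
  qed
  then obtain k where k: "k \<notin> \<kappa> ` {..<n}" "c n \<le> cmod (f k)" by blast
  have "inj_on (\<kappa>(n := k)) {..<Suc n}"
    using k \<kappa> by (auto simp: inj_on_def less_Suc_eq)
  moreover have "\<forall>i<Suc n. c i \<le> cmod (f ((\<kappa>(n := k)) i))"
    using k \<kappa> by (auto simp: less_Suc_eq)
  ultimately show ?case by blast
qed simp

text \<open>As \<open>h\<close> decreases, a modulus above \<open>h i\<close> can sit only at one of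
  the \<open>i\<close> positions \<open>\<kappa> j\<close> with \<open>j < i\<close>. The slack
  \<open>e\<close> keeps the level positive where \<open>h i = 0\<close>.\<close>

lemma rearr_transplant_le:
  assumes h: "antimono h" "\<And>i. 0 \<le> h i" "\<And>i. n < i \<Longrightarrow> h i = 0" and \<kappa>: "inj_on \<kappa> {..n}"
    and g: "\<And>i. i \<le> n \<Longrightarrow> g (\<kappa> i) = complex_of_real (h i)" "\<And>k. k \<notin> \<kappa> ` {..n} \<Longrightarrow> g k = 0"
  shows "rearr g i \<le> ennreal (h i)"
proof (rule ennreal_le_epsilon)
  fix e :: real assume "0 < e"
  let ?s = "h i + e"
  have "0 < ?s" using h(2)[of i] \<open>0 < e\<close> by simp
  have sub: "{k. ?s < cmod (g k)} \<subseteq> \<kappa> ` {..<i}"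
  proof
    fix k assume "k \<in> {k. ?s < cmod (g k)}"
    then have k: "?s < cmod (g k)" by simp
    then have "k \<in> \<kappa> ` {..n}" using g(2)[of k] \<open>0 < ?s\<close> by (cases "k \<in> \<kappa> ` {..n}") auto
    then obtain j where j: "j \<le> n" "k = \<kappa> j" by auto
    then have "h i < h j" using k g(1)[of j] h(2)[of j] \<open>0 < e\<close> by simp
    then have "j < i" using antimonoD[OF h(1), of i j] by (auto simp: not_less[symmetric])
    then show "k \<in> \<kappa> ` {..<i}" using j by auto
  qed
  have "finite {k. ?s < cmod (g k)}" by (rule finite_subset[OF sub]) simp
  moreover have "card {k. ?s < cmod (g k)} \<le> i"
    using card_mono[OF _ sub] card_image_le[of "{..<i}" \<kappa>] by simp
  ultimately have "rearr g i \<le> ennreal ?s"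
    unfolding rearr_def using \<open>0 < ?s\<close> by (intro Inf_lower) auto
  then show "rearr g i \<le> ennreal (h i) + ennreal e"
    using h(2)[of i] \<open>0 < e\<close> by simp
qed

text \<open>The sequence \<open>h\<close> is moved to indices where \<open>|f|\<close> nearly
  attains its rearrangement. The values of the rearrangement need not be attained, hence
  approximation from below and a limit.\<close>

lemma le_assoc_norm:
  assumes h: "antimono h" "\<And>i. 0 \<le> h i" "\<And>i. n < i \<Longrightarrow> h i = 0"
    and N: "\<And>g. (\<And>i. rearr g i \<le> ennreal (h i)) \<Longrightarrow> N g \<le> 1"
  shows "(\<Sum>i\<le>n. rearr f i * ennreal (h i)) \<le> assoc_norm N f"
proof -
  have below: "(\<Sum>i\<le>n. ennreal (c i) * ennreal (h i)) \<le> assoc_norm N f"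
    if c: "\<And>i. c i \<le> 0 \<or> ennreal (c i) < rearr f i" for c
  proof -
    obtain \<kappa> where \<kappa>: "inj_on \<kappa> {..n}" "\<And>i. i \<le> n \<Longrightarrow> c i \<le> cmod (f (\<kappa> i))"
      using exists_inj_above_rearr[OF c, of "Suc n"] by (auto simp: lessThan_Suc_atMost less_Suc_eq_le)
    define g where "g k = (if k \<in> \<kappa> ` {..n} then complex_of_real (h (the_inv_into {..n} \<kappa> k)) else 0)" for k
    have g: "g (\<kappa> i) = complex_of_real (h i)" if "i \<le> n" for i
      using that \<kappa>(1) by (simp add: g_def the_inv_into_f_f)
    have "N g \<le> 1"
    proof (rule N)
      show "rearr g i \<le> ennreal (h i)" for i
        by (rule rearr_transplant_le[OF h \<kappa>(1) g]) (auto simp: g_def)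
    qed
    have "(\<Sum>i\<le>n. ennreal (c i) * ennreal (h i)) \<le> (\<Sum>i\<le>n. ennreal (cmod (f (\<kappa> i) * g (\<kappa> i))))"
    proof (rule sum_mono)
      fix i assume "i \<in> {..n}"
      then have "ennreal (c i) * ennreal (h i) \<le> ennreal (cmod (f (\<kappa> i))) * ennreal (h i)"
        using \<kappa>(2) by (intro mult_right_mono ennreal_leI) auto
      then show "ennreal (c i) * ennreal (h i) \<le> ennreal (cmod (f (\<kappa> i) * g (\<kappa> i)))"
        using \<open>i \<in> {..n}\<close> h(2) by (simp add: g norm_mult ennreal_mult)
    qed
    also have "\<dots> = (\<Sum>k\<in>\<kappa> ` {..n}. ennreal (cmod (f k * g k)))"
      using \<kappa>(1) by (simp add: sum.reindex)
    also have "\<dots> \<le> (\<Sum>k. ennreal (cmod (f k * g k)))" by (intro sum_le_suminf) auto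
    also have "\<dots> \<le> assoc_norm N f"
      unfolding assoc_norm_def using \<open>N g \<le> 1\<close> by (intro SUP_upper) auto
    finally show ?thesis .
  qed
  \<comment> \<open>Strictly below a finite value, and growing through the integers below
    \<open>\<infinity>\<close>. Near the value 0 the approximant turns negative, a case that
    \<open>exists_inj_above_rearr\<close> admits explicitly.\<close>
  define c where "c m i = (if rearr f i = top then real m else enn2real (rearr f i) - 1 / real (Suc m))" for m i
  have c: "c m i \<le> 0 \<or> ennreal (c m i) < rearr f i" for m i
  proof (cases "rearr f i")
    case (real r)
    then have "c m i < r" by (simp add: c_def)
    then show ?thesis using real by (cases "c m i \<le> 0") (auto intro!: ennreal_lessI)
  qed (simp add: c_def)
  have lim: "(\<lambda>m. ennreal (c m i)) \<longlonglongrightarrow> rearr f i" for i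
  proof (cases "rearr f i")
    case (real r)
    have "(\<lambda>m. r - 1 / real (Suc m)) \<longlonglongrightarrow> r - 0"
      by (intro tendsto_diff tendsto_const LIMSEQ_Suc lim_inverse_n')
    then show ?thesis using real by (simp add: c_def tendsto_ennrealI)
  next
    case top
    then show ?thesis
      by (simp add: c_def ennreal_of_nat_eq_real_of_nat[symmetric] of_nat_tendsto_top_ennreal)
  qed
  have "(\<lambda>m. \<Sum>i\<le>n. ennreal (h i) * ennreal (c m i)) \<longlonglongrightarrow> (\<Sum>i\<le>n. ennreal (h i) * rearr f i)"
    by (intro tendsto_sum ennreal_tendsto_cmult lim) simp
  moreover have "(\<Sum>i\<le>n. ennreal (h i) * ennreal (c m i)) \<le> assoc_norm N f" for m
    using below[of "c m", OF c] by (simp add: mult.commute)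
  ultimately have "(\<Sum>i\<le>n. ennreal (h i) * rearr f i) \<le> assoc_norm N f"
    by (intro LIMSEQ_le_const2) auto
  then show ?thesis by (simp add: mult.commute)
qed

section \<open>Exponents at most one and the weak-type space\<close>

lemma psum_Suc [simp]: "psum \<Omega> (Suc n) = psum \<Omega> n + \<Omega> (Suc n)"
  by (simp add: psum_def)

lemma psum_0 [simp]: "psum \<Omega> 0 = \<Omega> 0"
  by (simp add: psum_def)

lemma psum_mono: "psum \<Omega> m \<le> psum \<Omega> n" if "\<And>n. 0 \<le> \<Omega> n" "m \<le> n"
  unfolding psum_def using that by (intro sum_mono2) auto

lemma psum_pos: "0 < psum \<Omega> n" if "\<And>n. 0 \<le> \<Omega> n" "\<Omega> 0 \<noteq> 0"
proof -
  have "0 < psum \<Omega> 0" using that by (simp add: less_le)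
  also have "\<dots> \<le> psum \<Omega> n" using that by (intro psum_mono) auto
  finally show ?thesis .
qed

lemma d_norm_le_one:
  assumes "0 < p" "\<And>n. 0 \<le> \<Omega> n" "\<And>i. 0 \<le> h i" "\<And>i. n < i \<Longrightarrow> h i = 0"
    and sum: "(\<Sum>i\<le>n. h i powr p * \<Omega> i) \<le> 1" and g: "\<And>i. rearr g i \<le> ennreal (h i)"
  shows "d_norm \<Omega> p g \<le> 1"
proof -
  have "(\<Sum>i. rearr g i epowr p * ennreal (\<Omega> i)) \<le> (\<Sum>i. ennreal (h i) epowr p * ennreal (\<Omega> i))"
    using assms by (intro suminf_le mult_right_mono ennreal_powr_mono) auto
  also have "\<dots> = (\<Sum>i. ennreal (h i powr p * \<Omega> i))"
    using assms by (simp add: ennreal_powr_ennreal ennreal_mult)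
  also have "\<dots> = (\<Sum>i\<le>n. ennreal (h i powr p * \<Omega> i))"
    using assms by (intro suminf_finite) auto
  also have "\<dots> = ennreal (\<Sum>i\<le>n. h i powr p * \<Omega> i)"
    using assms by (intro sum_ennreal) auto
  also have "\<dots> \<le> 1" using sum by (simp add: ennreal_le_1)
  finally show ?thesis
    unfolding d_norm_def using \<open>0 < p\<close> by (simp add: ennreal_powr_le_one_iff)
qed

text \<open>The positive weight at index 0 gives every unbounded sequence infinite norm, so the unit
  ball consists of bounded sequences.\<close>

lemma d_norm_le_oneD:
  assumes "0 < p" "\<And>n. 0 \<le> \<Omega> n" "\<Omega> 0 \<noteq> 0" and g: "d_norm \<Omega> p g \<le> 1"
  obtains b where "\<And>n. rearr g n = ennreal (b n)" "antimono b" "\<And>n. 0 \<le> b n"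
    "\<And>n. (\<Sum>i\<le>n. b i powr p * \<Omega> i) \<le> 1"
proof -
  have le: "(\<Sum>i. rearr g i epowr p * ennreal (\<Omega> i)) \<le> 1"
    using g \<open>0 < p\<close> unfolding d_norm_def by (simp add: ennreal_powr_le_one_iff)
  have "rearr g 0 \<noteq> top"
  proof
    assume "rearr g 0 = top"
    then have "rearr g 0 epowr p * ennreal (\<Omega> 0) = top"
      using assms(2)[of 0] assms(3) by (simp add: ennreal_powr_def ennreal_top_mult)
    then have "(\<Sum>i. rearr g i epowr p * ennreal (\<Omega> i)) = top"
      using sum_le_suminf[of "\<lambda>i. rearr g i epowr p * ennreal (\<Omega> i)" "{0}"]
      by (simp add: top_unique)
    then show False using le by (simp add: top_unique)
  qed
  then obtain b where b: "\<And>n. rearr g n = ennreal (b n)" "antimono b" "\<And>n. 0 \<le> b n"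
    by (rule rearr_real) blast
  have "(\<Sum>i. ennreal (b i powr p * \<Omega> i)) \<le> ennreal 1"
    using le b assms(2) by (simp add: ennreal_powr_ennreal ennreal_mult)
  then have "(\<Sum>i\<le>n. b i powr p * \<Omega> i) \<le> 1" for n
    using assms(2) by (intro sum_le_of_ennreal_suminf_le) auto
  then show thesis using that b by blast
qed

section \<open>Convexity and the case \<open>p \<le> 1\<close>\<close>

text \<open>Convexity as a comparison of increments: the same mass \<open>c\<close> raises the power
  more from a larger base. It is applied with \<open>r = 1 / p\<close>, which is where
  \<open>p \<le> 1\<close> enters.\<close>

lemma powr_add_minus_powr_mono:
  fixes r x y c :: real
  assumes "1 \<le> r" "0 \<le> x" "x \<le> y" "0 \<le> c"
  shows "(x + c) powr r - x powr r \<le> (y + c) powr r - y powr r"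
proof -
  let ?\<phi> = "\<lambda>t. (t + c) powr r - t powr r"
  show ?thesis
  proof (rule DERIV_nonneg_imp_increasing_open[OF \<open>x \<le> y\<close>])
    fix t assume t: "x < t" "t < y"
    have "(?\<phi> has_real_derivative r * (t + c) powr (r - 1) - r * t powr (r - 1)) (at t)"
      using t assms by (auto intro!: derivative_eq_intros)
    moreover have "0 \<le> r * (t + c) powr (r - 1) - r * t powr (r - 1)"
      using t assms by (auto intro!: mult_left_mono powr_mono2)
    ultimately show "\<exists>d. (?\<phi> has_real_derivative d) (at t) \<and> 0 \<le> d" by blast
  next
    show "continuous_on {x..y} ?\<phi>"
      using assms
      by (intro continuous_on_diff continuous_on_powr' continuous_on_add continuous_on_id continuous_on_const) auto
  qed
qed

text \<open>The free parameter \<open>y\<close>, standing for the next value of \<open>b\<close>, replaces a summation by parts.\<close>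

lemma sum_mult_le_powr_sum:
  fixes p M :: real and a b \<Omega> :: "nat \<Rightarrow> real"
  assumes p: "0 < p" "p \<le> 1" and \<Omega>: "\<And>n. 0 \<le> \<Omega> n" and b: "antimono b" and M: "0 \<le> M"
    and a: "\<And>n. (\<Sum>i\<le>n. a i) \<le> M * psum \<Omega> n powr (1 / p)"
    and y: "0 \<le> y" "y \<le> b n"
  shows "(\<Sum>i\<le>n. a i * (b i - y)) \<le>
    M * ((\<Sum>i\<le>n. b i powr p * \<Omega> i) powr (1 / p) - y * psum \<Omega> n powr (1 / p))"
  using y
proof (induction n arbitrary: y)
  case 0
  have "a 0 * (b 0 - y) \<le> M * \<Omega> 0 powr (1 / p) * (b 0 - y)"
    using a[of 0] 0 by (intro mult_right_mono) (auto simp: psum_def)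
  then show ?case using 0 p \<Omega> by (simp add: powr_mult powr_powr algebra_simps)
next
  case (Suc n)
  define z where "z = b (Suc n)"
  define S where "S = (\<Sum>i\<le>n. b i powr p * \<Omega> i)"
  have z: "0 \<le> z" "z \<le> b n" "y \<le> z"
    using Suc.prems antimonoD[OF b, of n "Suc n"] by (auto simp: z_def)
  \<comment> \<open>\<open>S\<close> dominates the mass of the constant sequence \<open>z\<close>.
    Convexity then trades the increment starting at \<open>z powr p * psum \<Omega> n\<close>, which
    the bound on \<open>a\<close> produces, for the increment starting at \<open>S\<close>.\<close>
  have "z powr p * psum \<Omega> n \<le> S"
    unfolding S_def psum_def sum_distrib_left
  proof (intro sum_mono mult_right_mono powr_mono2)
    show "z \<le> b i" if "i \<in> {..n}" for i
      using that antimonoD[OF b, of i n] z by simp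
  qed (use p \<Omega> z in auto)
  then have "(z powr p * psum \<Omega> n + z powr p * \<Omega> (Suc n)) powr (1 / p) - (z powr p * psum \<Omega> n) powr (1 / p)
      \<le> (S + z powr p * \<Omega> (Suc n)) powr (1 / p) - S powr (1 / p)"
    using p \<Omega> by (intro powr_add_minus_powr_mono) (auto simp: psum_def intro!: mult_nonneg_nonneg sum_nonneg)
  moreover have "(z powr p * psum \<Omega> n + z powr p * \<Omega> (Suc n)) = z powr p * psum \<Omega> (Suc n)"
    by (simp add: algebra_simps)
  moreover have "(z powr p * psum \<Omega> k) powr (1 / p) = z * psum \<Omega> k powr (1 / p)" for k
    using p z \<Omega> by (simp add: powr_mult powr_powr psum_def sum_nonneg)
  ultimately have step: "z * psum \<Omega> (Suc n) powr (1 / p) - z * psum \<Omega> n powr (1 / p)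
      \<le> (S + z powr p * \<Omega> (Suc n)) powr (1 / p) - S powr (1 / p)"
    by (simp del: psum_Suc)
  have "(\<Sum>i\<le>Suc n. a i * (b i - y)) =
      (\<Sum>i\<le>Suc n. a i * (b i - z)) + (z - y) * (\<Sum>i\<le>Suc n. a i)"
    unfolding sum_distrib_left sum.distrib[symmetric] by (intro sum.cong) (auto simp: algebra_simps)
  \<comment> \<open>At level \<open>z = b (Suc n)\<close> the last summand vanishes, so the
    induction hypothesis applies.\<close>
  also have "\<dots> = (\<Sum>i\<le>n. a i * (b i - z)) + (z - y) * (\<Sum>i\<le>Suc n. a i)"
    by (simp add: z_def)
  also have "\<dots> \<le> M * (S powr (1 / p) - z * psum \<Omega> n powr (1 / p))
      + (z - y) * (M * psum \<Omega> (Suc n) powr (1 / p))"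
    using Suc.IH[of z] z a[of "Suc n"] unfolding S_def by (intro add_mono mult_left_mono) auto
  also have "\<dots> = M * (S powr (1 / p) - z * psum \<Omega> n powr (1 / p)
      + z * psum \<Omega> (Suc n) powr (1 / p) - y * psum \<Omega> (Suc n) powr (1 / p))"
    by (simp add: algebra_simps)
  also have "\<dots> \<le> M * ((S + z powr p * \<Omega> (Suc n)) powr (1 / p) - y * psum \<Omega> (Suc n) powr (1 / p))"
    using step by (intro mult_left_mono M) linarith
  finally show ?case by (simp add: S_def z_def)
qed

text \<open>A spike of height \<open>c\<close> on a single index lies in the unit ball and can be
  placed where \<open>|f|\<close> is as large as desired.\<close>

lemma assoc_norm_eq_top:
  assumes "rearr f 0 = top" "0 < c"
    and "\<And>g. (\<And>i. rearr g i \<le> ennreal (if i = 0 then c else 0)) \<Longrightarrow> N g \<le> 1"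
  shows "assoc_norm N f = top"
proof -
  have "(\<Sum>i\<le>0. rearr f i * ennreal (if i = 0 then c else 0)) \<le> assoc_norm N f"
    by (rule le_assoc_norm) (use assms in \<open>auto simp: antimono_def\<close>)
  then show ?thesis using assms(1,2) by (simp add: ennreal_top_mult top_unique)
qed

lemma assoc_d_norm_eq_top:
  assumes "0 < p" "\<And>n. 0 \<le> \<Omega> n" "\<Omega> 0 \<noteq> 0" "rearr f 0 = top"
  shows "assoc_norm (d_norm \<Omega> p) f = top"
proof (rule assoc_norm_eq_top)
  have "0 < \<Omega> 0" using assms(2)[of 0] assms(3) by simp
  then show "0 < \<Omega> 0 powr (-1 / p)" by simp
  have "(\<Omega> 0 powr (-1 / p)) powr p * \<Omega> 0 = 1"
    using \<open>0 < \<Omega> 0\<close> \<open>0 < p\<close> by (simp add: powr_powr powr_neg_one)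
  then show "d_norm \<Omega> p g \<le> 1" if "\<And>i. rearr g i \<le> ennreal (if i = 0 then \<Omega> 0 powr (-1 / p) else 0)" for g
    using assms(1,2) that \<open>0 < \<Omega> 0\<close>
    by (intro d_norm_le_one[where n = 0 and h = "\<lambda>i. if i = 0 then \<Omega> 0 powr (-1 / p) else 0"])
      auto
qed fact

text \<open>Normalised indicators of \<open>{..n}\<close> are extremal; the upper bound is
  \<open>sum_mult_le_powr_sum\<close> at \<open>y = 0\<close>.\<close>

lemma assoc_d_norm_p_le_1:
  assumes p: "0 < p" "p \<le> 1" and \<Omega>: "\<And>n. 0 \<le> \<Omega> n" "\<Omega> 0 \<noteq> 0"
  shows "assoc_norm (d_norm \<Omega> p) f = (SUP n. ennreal (psum \<Omega> n powr (- 1 / p)) * (\<Sum>k\<le>n. rearr f k))"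
    (is "?L = ?R")
proof (rule antisym)
  have W: "0 < psum \<Omega> n" for n using \<Omega> by (rule psum_pos)
  show "?L \<le> ?R"
  proof (cases ?R)
    case (real M)
    have "rearr f 0 \<noteq> top"
    proof
      assume "rearr f 0 = top"
      then have "ennreal (psum \<Omega> 0 powr (- 1 / p)) * (\<Sum>k\<le>0. rearr f k) = top"
        using W[of 0] by (simp add: ennreal_mult_top)
      moreover have "ennreal (psum \<Omega> 0 powr (- 1 / p)) * (\<Sum>k\<le>0. rearr f k) \<le> ?R"
        by (rule SUP_upper) simp
      ultimately show False unfolding real(2) by (simp add: top_unique)
    qed
    then obtain a where a: "\<And>n. rearr f n = ennreal (a n)" "\<And>n. 0 \<le> a n"
      by (rule rearr_real) blast
    have sum: "(\<Sum>k\<le>n. a k) \<le> M * psum \<Omega> n powr (1 / p)" for n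
    proof -
      have "ennreal (psum \<Omega> n powr (- 1 / p)) * (\<Sum>k\<le>n. rearr f k) \<le> ennreal M"
        unfolding real(2)[symmetric] by (rule SUP_upper) simp
      then have "ennreal (psum \<Omega> n powr (- 1 / p) * (\<Sum>k\<le>n. a k)) \<le> ennreal M"
        using a by (simp add: ennreal_mult sum_nonneg)
      then have "psum \<Omega> n powr (- 1 / p) * (\<Sum>k\<le>n. a k) \<le> M"
        using real(1) by (simp add: ennreal_le_iff)
      then show ?thesis using W[of n] by (simp add: powr_minus_divide divide_le_eq)
    qed
    show ?thesis unfolding real(2)
    proof (rule assoc_norm_le[OF a])
      fix g assume "d_norm \<Omega> p g \<le> 1"
      then obtain b where b: "\<And>n. rearr g n = ennreal (b n)" "antimono b" "\<And>n. 0 \<le> b n"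
        "\<And>n. (\<Sum>i\<le>n. b i powr p * \<Omega> i) \<le> 1"
        using d_norm_le_oneD[of p \<Omega> g, OF p(1) \<Omega>] by blast
      have "(\<Sum>i\<le>n. a i * b i) \<le> M" for n
      proof -
        have "(\<Sum>i\<le>n. a i * (b i - 0)) \<le>
            M * ((\<Sum>i\<le>n. b i powr p * \<Omega> i) powr (1 / p) - 0 * psum \<Omega> n powr (1 / p))"
          using b by (intro sum_mult_le_powr_sum p \<Omega> real sum) auto
        also have "\<dots> \<le> M * (1 powr (1 / p))"
        proof -
          have "0 \<le> (\<Sum>i\<le>n. b i powr p * \<Omega> i)" using \<Omega> by (simp add: sum_nonneg)
          then have "(\<Sum>i\<le>n. b i powr p * \<Omega> i) powr (1 / p) \<le> 1 powr (1 / p)"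
            using b(4) p by (intro powr_mono2) auto
          from mult_left_mono[OF this real(1)] show ?thesis by simp
        qed
        finally show ?thesis by simp
      qed
      then show "\<exists>b. (\<forall>n. rearr g n = ennreal (b n)) \<and> (\<forall>n. 0 \<le> b n) \<and> (\<forall>n. (\<Sum>i\<le>n. a i * b i) \<le> M)"
        using b by blast
    qed
  next
    case top
    show ?thesis unfolding top by simp
  qed
  show "?R \<le> ?L"
  proof (rule SUP_least)
    fix n
    define h where "h i = (if i \<le> n then psum \<Omega> n powr (- 1 / p) else 0)" for i
    have "(\<Sum>i\<le>n. h i powr p * \<Omega> i) = (psum \<Omega> n powr (- 1 / p)) powr p * psum \<Omega> n"
      by (simp add: h_def psum_def sum_distrib_left)
    also have "\<dots> = 1" using W[of n] p by (simp add: powr_powr powr_neg_one)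
    finally have norm: "(\<Sum>i\<le>n. h i powr p * \<Omega> i) \<le> 1" by simp
    have h: "antimono h" "\<And>i. 0 \<le> h i" "\<And>i. n < i \<Longrightarrow> h i = 0"
      by (auto simp: h_def antimono_def)
    have "ennreal (psum \<Omega> n powr (- 1 / p)) * (\<Sum>k\<le>n. rearr f k) = (\<Sum>i\<le>n. rearr f i * ennreal (h i))"
      unfolding sum_distrib_left by (intro sum.cong) (auto simp: h_def mult.commute)
    also have "\<dots> \<le> ?L"
      by (rule le_assoc_norm[OF h]) (assumption | rule d_norm_le_one[OF p(1) \<Omega>(1) h(2,3) norm])+
    finally show "ennreal (psum \<Omega> n powr (- 1 / p)) * (\<Sum>k\<le>n. rearr f k) \<le> ?L" .
  qed
qed

text \<open>Every rearrangement from the unit ball lies pointwise below \<open>W^(-1/p)\<close>, and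
  this sequence is itself decreasing, so its truncations are admissible tests that exhaust the
  bound.\<close>

lemma assoc_dinf_norm:
  assumes p: "0 < p" and \<Omega>: "\<And>n. 0 \<le> \<Omega> n" "\<Omega> 0 \<noteq> 0"
  shows "assoc_norm (dinf_norm \<Omega> p) f = (\<Sum>n. rearr f n * ennreal (psum \<Omega> n powr (- 1 / p)))"
    (is "?L = ?R")
proof (rule antisym)
  have W: "0 < psum \<Omega> n" for n using \<Omega> by (rule psum_pos)
  have inv: "psum \<Omega> n powr (- 1 / p) = inverse (psum \<Omega> n powr (1 / p))" for n
    by (simp add: powr_minus)
  show "?L \<le> ?R"
  proof (cases ?R)
    case (real M)
    have "rearr f 0 \<noteq> top"
    proof
      assume "rearr f 0 = top"
      then have "?R = top"
        using sum_le_suminf[of "\<lambda>n. rearr f n * ennreal (psum \<Omega> n powr (- 1 / p))" "{0}"] W[of 0]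
        by (simp add: ennreal_top_mult top_unique)
      then show False using real(2) by simp
    qed
    then obtain a where a: "\<And>n. rearr f n = ennreal (a n)" "\<And>n. 0 \<le> a n"
      by (rule rearr_real) blast
    show ?thesis unfolding real(2)
    proof (rule assoc_norm_le[OF a])
      fix g assume g: "dinf_norm \<Omega> p g \<le> 1"
      have le: "ennreal (psum \<Omega> n powr (1 / p)) * rearr g n \<le> 1" for n
        using g unfolding dinf_norm_def by (meson SUP_upper UNIV_I order_trans)
      have "rearr g 0 \<noteq> top"
        using le[of 0] W[of 0] by (auto simp: ennreal_mult_top top_unique)
      then obtain b where b: "\<And>n. rearr g n = ennreal (b n)" "\<And>n. 0 \<le> b n"
        by (rule rearr_real) blast
      have b_le: "b n \<le> psum \<Omega> n powr (- 1 / p)" for n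
      proof -
        have "ennreal (psum \<Omega> n powr (1 / p) * b n) \<le> 1"
          using le[of n] b by (simp add: ennreal_mult)
        then show ?thesis unfolding inv using W[of n] by (simp add: ennreal_le_1 field_simps)
      qed
      have "(\<Sum>i\<le>n. a i * b i) \<le> M" for n
      proof -
        have "(\<Sum>i\<le>n. a i * b i) \<le> (\<Sum>i\<le>n. a i * psum \<Omega> i powr (- 1 / p))"
          using b_le a by (intro sum_mono mult_left_mono) auto
        also have "\<dots> \<le> M"
        proof (rule sum_le_of_ennreal_suminf_le)
          show "(\<Sum>n. ennreal (a n * psum \<Omega> n powr (- 1 / p))) \<le> ennreal M"
            using a real by (simp add: ennreal_mult)
        qed (use a real in auto)
        finally show ?thesis .
      qed
      then show "\<exists>b. (\<forall>n. rearr g n = ennreal (b n)) \<and> (\<forall>n. 0 \<le> b n) \<and> (\<forall>n. (\<Sum>i\<le>n. a i * b i) \<le> M)"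
        using b by blast
    qed
  next
    case top
    show ?thesis unfolding top by simp
  qed
  have "(\<Sum>i<n. rearr f i * ennreal (psum \<Omega> i powr (- 1 / p))) \<le> ?L" for n
  proof -
    define h where "h i = (if i \<le> n then psum \<Omega> i powr (- 1 / p) else 0)" for i
    have "antimono h"
      using psum_mono[OF \<Omega>(1)] W p
      by (auto simp: h_def antimono_def intro!: powr_mono2')
    then have "(\<Sum>i\<le>n. rearr f i * ennreal (h i)) \<le> ?L"
    proof (rule le_assoc_norm)
      fix g assume g: "\<And>i. rearr g i \<le> ennreal (h i)"
      show "dinf_norm \<Omega> p g \<le> 1"
        unfolding dinf_norm_def
      proof (rule SUP_least)
        fix i
        have "ennreal (psum \<Omega> i powr (1 / p)) * rearr g i \<le> ennreal (psum \<Omega> i powr (1 / p)) * ennreal (h i)"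
          by (intro mult_left_mono g) simp
        also have "\<dots> = ennreal (psum \<Omega> i powr (1 / p) * h i)"
          by (simp add: ennreal_mult h_def)
        also have "\<dots> \<le> 1" unfolding ennreal_le_1 h_def inv using W[of i] by simp
        finally show "ennreal (psum \<Omega> i powr (1 / p)) * rearr g i \<le> 1" .
      qed
    qed (auto simp: h_def)
    moreover have "(\<Sum>i<n. rearr f i * ennreal (psum \<Omega> i powr (- 1 / p))) \<le> (\<Sum>i\<le>n. rearr f i * ennreal (h i))"
    proof -
      have "(\<Sum>i<n. rearr f i * ennreal (psum \<Omega> i powr (- 1 / p))) = (\<Sum>i<n. rearr f i * ennreal (h i))"
        by (simp add: h_def)
      also have "\<dots> \<le> (\<Sum>i\<le>n. rearr f i * ennreal (h i))" by (intro sum_mono2) auto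
      finally show ?thesis .
    qed
    ultimately show ?thesis by (rule order_trans[rotated])
  qed
  then show "?R \<le> ?L" unfolding suminf_eq_SUP by (intro SUP_least)
qed

lemma d_norm_exponent_1: "d_norm w 1 f = (\<Sum>n. rearr f n * ennreal (w n))"
proof -
  have "x epowr 1 = x" for x by (cases x) (auto simp: ennreal_powr_def)
  then show ?thesis by (simp add: d_norm_def)
qed

section \<open>Abel sums and the dual weight\<close>

lemma powr_minus_one_mult: "x powr (q - 1) * x = x powr q" if "0 \<le> x" for x q :: real
  using powr_mult_base[OF that, of "q - 1"] by (simp add: mult.commute)

lemma powr_diff_lower:
  fixes q x y :: real
  assumes "1 \<le> q" "0 \<le> x" "x \<le> y"
  shows "y powr (q - 1) * (y - x) \<le> y powr q - x powr q"
proof -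
  have "x powr (q - 1) * x \<le> y powr (q - 1) * x"
    using assms by (intro mult_right_mono powr_mono2) auto
  then show ?thesis
    using assms powr_minus_one_mult[of x q] powr_minus_one_mult[of y q] by (simp add: algebra_simps)
qed

text \<open>Compares the power with its tangent at the right endpoint. This is the origin of the
  factor \<open>q\<close> in the constant \<open>C2\<close>.\<close>

lemma powr_diff_upper:
  fixes q x y :: real
  assumes "1 \<le> q" "0 \<le> x" "x \<le> y"
  shows "y powr q - x powr q \<le> q * y powr (q - 1) * (y - x)"
proof -
  let ?\<phi> = "\<lambda>t. q * y powr (q - 1) * t - t powr q"
  have "?\<phi> x \<le> ?\<phi> y"
  proof (rule DERIV_nonneg_imp_increasing_open[OF \<open>x \<le> y\<close>])
    fix t assume t: "x < t" "t < y"
    have "(?\<phi> has_real_derivative q * y powr (q - 1) - q * t powr (q - 1)) (at t)"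
      using t assms by (auto intro!: derivative_eq_intros)
    moreover have "0 \<le> q * y powr (q - 1) - q * t powr (q - 1)"
      using t assms by (auto intro!: mult_left_mono powr_mono2)
    ultimately show "\<exists>d. (?\<phi> has_real_derivative d) (at t) \<and> 0 \<le> d" by blast
  next
    show "continuous_on {x..y} ?\<phi>"
      using assms by (intro continuous_on_diff continuous_on_mult continuous_on_powr' continuous_on_id continuous_on_const) auto
  qed
  then show ?thesis by (simp add: algebra_simps)
qed

section \<open>Comparison of the Abel sum with the dual sum\<close>

text \<open>A discrete Stieltjes integral of \<open>v\<close> against \<open>du\<close>, with
  \<open>v\<close> at the right endpoint and \<open>u\<close> continued by 0 to the left of index
  0.\<close>

definition abel_sum :: "(nat \<Rightarrow> real) \<Rightarrow> (nat \<Rightarrow> real) \<Rightarrow> nat \<Rightarrow> real" where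
  "abel_sum u v N = u 0 * v 0 + (\<Sum>i<N. (u (Suc i) - u i) * v (Suc i))"

lemma abel_sum_0 [simp]: "abel_sum u v 0 = u 0 * v 0"
  by (simp add: abel_sum_def)

lemma abel_sum_Suc [simp]: "abel_sum u v (Suc N) = abel_sum u v N + (u (Suc N) - u N) * v (Suc N)"
  by (simp add: abel_sum_def)

lemma abel_sum_by_parts: "abel_sum u v N = u N * v N + (\<Sum>i<N. u i * (v i - v (Suc i)))"
  by (induction N) (auto simp: algebra_simps)

lemma abel_sum_nonneg: "0 \<le> abel_sum u v N" if "mono u" "\<And>n. 0 \<le> u n" "\<And>n. 0 \<le> v n"
  unfolding abel_sum_def using that
  by (intro add_nonneg_nonneg mult_nonneg_nonneg sum_nonneg) (auto simp: mono_def)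

text \<open>The increment of the potential \<open>2 * abel_sum u v n - u n * v n\<close> between neighbours is
  \<open>(u (n + 1) - u n) * v (n + 1) + u n * (v n - v (n + 1))\<close>.\<close>

lemma abel_sum_increment:
  assumes u: "mono u" and v: "antimono v" and "j \<le> N"
  shows "(u N - u j) * v N + u j * (v j - v N)
    \<le> (2 * abel_sum u v N - u N * v N) - (2 * abel_sum u v j - u j * v j)"
  using \<open>j \<le> N\<close>
proof (induction N rule: dec_induct)
  case (step N)
  have "0 \<le> (u N - u j) * (v N - v (Suc N))"
    using monoD[OF u, of j N] antimonoD[OF v, of N "Suc N"] step by simp
  then show ?case using step by (simp add: algebra_simps)
qed simp

text \<open>For \<open>u = F^q\<close> and \<open>v = W^(1-q)\<close> this is the summand of the
  dual sum once the powers of \<open>n + 1\<close> have cancelled.\<close>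

definition dual_term :: "(nat \<Rightarrow> real) \<Rightarrow> (nat \<Rightarrow> real) \<Rightarrow> nat \<Rightarrow> real" where
  "dual_term u v n = (case n of 0 \<Rightarrow> u 0 * v 0 | Suc m \<Rightarrow> u n * (v m - v n))"

lemma dual_term_nonneg: "0 \<le> dual_term u v n"
  if "antimono v" "\<And>n. 0 \<le> u n" "\<And>n. 0 \<le> v n"
  using that by (auto simp: dual_term_def antimono_def split: nat.split)

text \<open>Two separate bounds allow \<open>M\<close> to tend to infinity with \<open>N\<close>
  fixed, so that the boundary term \<open>u N * v M\<close> disappears. Beyond \<open>N\<close> the
  differences of \<open>v\<close> telescope with weights at least \<open>u N\<close>.\<close>

lemma abel_sum_le_dual_sum:
  assumes u: "mono u" "\<And>n. 0 \<le> u n" and v: "antimono v" "\<And>n. 0 \<le> v n" and "N \<le> M"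
  shows "abel_sum u v N - u N * v M \<le> (\<Sum>n\<le>M. dual_term u v n)"
  using \<open>N \<le> M\<close>
proof (induction M rule: dec_induct)
  case base
  show ?case
  proof (induction N)
    case 0
    show ?case using u v by (simp add: dual_term_def)
  next
    case (Suc N)
    have "u N * (v N - v (Suc N)) \<le> u (Suc N) * (v N - v (Suc N))"
      using monoD[OF u(1), of N "Suc N"] antimonoD[OF v(1), of N "Suc N"] by (intro mult_right_mono) auto
    then show ?case using Suc by (simp add: dual_term_def algebra_simps)
  qed
next
  case (step M)
  have "u N * (v M - v (Suc M)) \<le> u (Suc M) * (v M - v (Suc M))"
    using monoD[OF u(1), of N "Suc M"] antimonoD[OF v(1), of M "Suc M"] step by (intro mult_right_mono) auto
  then show ?case using step by (simp add: dual_term_def algebra_simps)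
qed

text \<open>Summation by parts gives the weight \<open>u i\<close> where the dual sum has
  \<open>u (Suc i)\<close>; the shift costs the factor \<open>K\<close>.\<close>

lemma dual_sum_le_abel_sum:
  assumes u: "mono u" "\<And>n. 0 \<le> u n" and v: "antimono v" "\<And>n. 0 \<le> v n"
    and doubling: "\<And>n. u (Suc n) \<le> K * u n" and "0 \<le> K"
  shows "(\<Sum>n\<le>N. dual_term u v n) \<le> (1 + K) * abel_sum u v N"
proof -
  have "(\<Sum>n\<le>N. dual_term u v n) = u 0 * v 0 + (\<Sum>i<N. u (Suc i) * (v i - v (Suc i)))"
    by (induction N) (auto simp: dual_term_def)
  also have "u 0 * v 0 \<le> abel_sum u v N"
    unfolding abel_sum_def using u v by (auto intro!: sum_nonneg mult_nonneg_nonneg simp: mono_def)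
  also have "(\<Sum>i<N. u (Suc i) * (v i - v (Suc i))) \<le> (\<Sum>i<N. K * (u i * (v i - v (Suc i))))"
  proof (rule sum_mono)
    fix i
    have "u (Suc i) * (v i - v (Suc i)) \<le> (K * u i) * (v i - v (Suc i))"
      using antimonoD[OF v(1), of i "Suc i"] by (intro mult_right_mono doubling) auto
    then show "u (Suc i) * (v i - v (Suc i)) \<le> K * (u i * (v i - v (Suc i)))"
      by (simp add: mult.assoc)
  qed
  also have "\<dots> = K * (abel_sum u v N - u N * v N)"
    unfolding abel_sum_by_parts by (simp add: sum_distrib_left)
  also have "\<dots> \<le> K * abel_sum u v N"
    using u v \<open>0 \<le> K\<close> by (intro mult_left_mono) auto
  finally show ?thesis by (simp add: algebra_simps)
qed

section \<open>The Young inequality behind the upper bound\<close>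

text \<open>Cut into horizontal layers: the layer from \<open>y\<close> to \<open>z = b n\<close>
  contributes \<open>(z - y) * psum c n\<close>, at most
  \<open>(z powr p - y powr p) * psum \<Omega> n\<close>. Where \<open>c\<close> vanishes no bound
  is assumed, since \<open>c\<close> will be a sequence with its bad entries erased; there the level
  is left at \<open>y\<close>.\<close>

lemma sum_mult_le_sum_powr:
  fixes p :: real and b c \<Omega> :: "nat \<Rightarrow> real"
  assumes p: "1 \<le> p" and \<Omega>: "\<And>n. 0 \<le> \<Omega> n" and b: "antimono b"
    and c: "\<And>n. c n \<noteq> 0 \<Longrightarrow> psum c n \<le> b n powr (p - 1) * psum \<Omega> n"
    and y: "0 \<le> y" "y \<le> b n"
  shows "(\<Sum>i\<le>n. c i * (b i - y)) \<le> (\<Sum>i\<le>n. (b i powr p - y powr p) * \<Omega> i)"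
  using y
proof (induction n arbitrary: y)
  case 0
  show ?case
  proof (cases "c 0 = 0")
    case True
    then show ?thesis using 0 \<Omega> p by (simp add: powr_mono2)
  next
    case False
    have "c 0 * (b 0 - y) \<le> (b 0 powr (p - 1) * \<Omega> 0) * (b 0 - y)"
      using c[OF False] 0 by (intro mult_right_mono) auto
    also have "\<dots> = (b 0 powr (p - 1) * (b 0 - y)) * \<Omega> 0" by simp
    also have "\<dots> \<le> (b 0 powr p - y powr p) * \<Omega> 0"
      using 0 p \<Omega> by (intro mult_right_mono powr_diff_lower) auto
    finally show ?thesis by simp
  qed
next
  case (Suc n)
  define z where "z = b (Suc n)"
  have z: "0 \<le> z" "z \<le> b n" "y \<le> z"
    using Suc.prems antimonoD[OF b, of n "Suc n"] by (auto simp: z_def)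
  show ?case
  proof (cases "c (Suc n) = 0")
    case True
    have "0 \<le> (b (Suc n) powr p - y powr p) * \<Omega> (Suc n)"
      using Suc.prems \<Omega> p by (simp add: powr_mono2)
    then show ?thesis using Suc.IH[of y] Suc.prems z True by simp
  next
    case False
    have "(\<Sum>i\<le>Suc n. c i * (b i - y)) = (\<Sum>i\<le>Suc n. c i * (b i - z)) + (z - y) * psum c (Suc n)"
      unfolding psum_def sum_distrib_left sum.distrib[symmetric]
      by (intro sum.cong) (auto simp: algebra_simps)
    also have "(\<Sum>i\<le>Suc n. c i * (b i - z)) \<le> (\<Sum>i\<le>Suc n. (b i powr p - z powr p) * \<Omega> i)"
      using Suc.IH[of z] z by (simp add: z_def)
    also have "(z - y) * psum c (Suc n) \<le> (z - y) * (z powr (p - 1) * psum \<Omega> (Suc n))"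
      using c[OF False] z unfolding z_def by (intro mult_left_mono) auto
    also have "\<dots> = (z powr (p - 1) * (z - y)) * psum \<Omega> (Suc n)" by simp
    also have "\<dots> \<le> (z powr p - y powr p) * psum \<Omega> (Suc n)"
      using z p \<Omega> Suc.prems by (intro mult_right_mono powr_diff_lower) (auto simp: psum_def intro!: sum_nonneg add_nonneg_nonneg)
    also have "(\<Sum>i\<le>Suc n. (b i powr p - z powr p) * \<Omega> i) + (z powr p - y powr p) * psum \<Omega> (Suc n)
        = (\<Sum>i\<le>Suc n. (b i powr p - y powr p) * \<Omega> i)"
      unfolding psum_def sum_distrib_left sum.distrib[symmetric]
      by (intro sum.cong) (auto simp: algebra_simps)
    finally show ?thesis by simp
  qed
qed

lemma conjugate_exponent:
  fixes p q :: real
  assumes "1 < p" "1 / p + 1 / q = 1"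
  shows "1 < q" "(p - 1) * (q - 1) = 1" "p * (q - 1) = q"
proof -
  have "q \<noteq> 0" using assms by auto
  then have "q + p = p * q" using assms by (simp add: field_simps)
  then show "(p - 1) * (q - 1) = 1" "p * (q - 1) = q" by (auto simp: algebra_simps)
  then have "0 < q - 1" using assms(1) zero_less_mult_iff[of "p - 1" "q - 1"] by auto
  then show "1 < q" by simp
qed

text \<open>Indices with \<open>psum a n \<le> b n powr (p - 1) * psum \<Omega> n\<close> are charged to the norm of \<open>b\<close>,
  all others to the dual sum.\<close>

lemma sum_mult_le_abel_sum_add:
  fixes p q :: real and a b \<Omega> :: "nat \<Rightarrow> real"
  assumes pq: "1 < p" "1 / p + 1 / q = 1" and \<Omega>: "\<And>n. 0 \<le> \<Omega> n" "\<Omega> 0 \<noteq> 0"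
    and a: "\<And>n. 0 \<le> a n" and b: "antimono b" "\<And>n. 0 \<le> b n"
  shows "(\<Sum>i\<le>N. a i * b i) \<le>
    abel_sum (\<lambda>n. psum a n powr q) (\<lambda>n. psum \<Omega> n powr (1 - q)) N + (\<Sum>i\<le>N. b i powr p * \<Omega> i)"
proof -
  note q = conjugate_exponent[OF pq]
  define c where "c i = (if psum a i \<le> b i powr (p - 1) * psum \<Omega> i then a i else 0)" for i
  have W: "0 < psum \<Omega> n" for n using \<Omega> by (rule psum_pos)
  have F: "0 \<le> psum a n" for n using a by (simp add: psum_def sum_nonneg)
  have "psum c n \<le> psum a n" for n
    unfolding psum_def by (rule sum_mono) (simp add: c_def a)
  then have "psum c n \<le> b n powr (p - 1) * psum \<Omega> n" if "c n \<noteq> 0" for n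
    using that by (auto simp: c_def split: if_splits intro: order_trans)
  then have "(\<Sum>i\<le>N. c i * (b i - 0)) \<le> (\<Sum>i\<le>N. (b i powr p - 0 powr p) * \<Omega> i)"
    using b pq by (intro sum_mult_le_sum_powr \<Omega>) auto
  then have good: "(\<Sum>i\<le>N. c i * b i) \<le> (\<Sum>i\<le>N. b i powr p * \<Omega> i)" by simp
  \<comment> \<open>Only bad indices contribute. There \<open>b i powr (p - 1)\<close> is below
    \<open>psum a i / psum \<Omega> i\<close>, and raising to the power \<open>q - 1\<close>
    isolates \<open>b i\<close> because \<open>(p - 1) * (q - 1) = 1\<close>.\<close>
  have "(a i - c i) * b i \<le> a i * (psum a i powr (q - 1) * psum \<Omega> i powr (1 - q))" for i
  proof (cases "psum a i \<le> b i powr (p - 1) * psum \<Omega> i")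
    case False
    then have "b i powr (p - 1) \<le> psum a i / psum \<Omega> i" using W[of i] by (simp add: field_simps)
    then have "(b i powr (p - 1)) powr (q - 1) \<le> (psum a i / psum \<Omega> i) powr (q - 1)"
      using q by (intro powr_mono2) auto
    then have "b i \<le> (psum a i / psum \<Omega> i) powr (q - 1)"
      using b(2)[of i] q(2) by (simp add: powr_powr)
    also have "\<dots> = psum a i powr (q - 1) * psum \<Omega> i powr (1 - q)"
      using F[of i] W[of i] powr_minus[of "psum \<Omega> i" "q - 1"] by (simp add: powr_divide field_simps)
    finally show ?thesis using a[of i] False by (simp add: c_def mult_left_mono)
  qed (simp add: c_def a)
  then have "(\<Sum>i\<le>N. (a i - c i) * b i) \<le> (\<Sum>i\<le>N. a i * (psum a i powr (q - 1) * psum \<Omega> i powr (1 - q)))"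
    by (intro sum_mono)
  also have "\<dots> \<le> abel_sum (\<lambda>n. psum a n powr q) (\<lambda>n. psum \<Omega> n powr (1 - q)) N"
  proof (induction N)
    case 0
    have "a 0 * a 0 powr (q - 1) = a 0 powr q"
      using powr_minus_one_mult[of "a 0" q] a[of 0] by (simp add: mult.commute)
    then show ?case by (simp flip: mult.assoc)
  next
    case (Suc N)
    have "psum a (Suc N) powr (q - 1) * (psum a (Suc N) - psum a N) \<le> psum a (Suc N) powr q - psum a N powr q"
      using q F[of N] a[of "Suc N"] by (intro powr_diff_lower) auto
    then have "a (Suc N) * psum a (Suc N) powr (q - 1) \<le> psum a (Suc N) powr q - psum a N powr q"
      by (simp add: mult.commute)
    then have "a (Suc N) * psum a (Suc N) powr (q - 1) * psum \<Omega> (Suc N) powr (1 - q)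
        \<le> (psum a (Suc N) powr q - psum a N powr q) * psum \<Omega> (Suc N) powr (1 - q)"
      by (rule mult_right_mono) simp
    then show ?case using Suc by (simp add: mult.assoc)
  qed
  finally have "(\<Sum>i\<le>N. (a i - c i) * b i) \<le> abel_sum (\<lambda>n. psum a n powr q) (\<lambda>n. psum \<Omega> n powr (1 - q)) N" .
  moreover have "(\<Sum>i\<le>N. a i * b i) = (\<Sum>i\<le>N. (a i - c i) * b i) + (\<Sum>i\<le>N. c i * b i)"
    by (simp add: sum.distrib[symmetric] algebra_simps)
  ultimately show ?thesis using good by linarith
qed

text \<open>Rescaling \<open>b\<close> by \<open>K powr (1 / p)\<close> balances the two terms of
  the additive bound: each is then at most \<open>K\<close>.\<close>

lemma sum_mult_le_two_mult_powr:
  fixes p q K :: real and a b \<Omega> :: "nat \<Rightarrow> real"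
  assumes pq: "1 < p" "1 / p + 1 / q = 1" and \<Omega>: "\<And>n. 0 \<le> \<Omega> n" "\<Omega> 0 \<noteq> 0"
    and a: "\<And>n. 0 \<le> a n" and b: "antimono b" "\<And>n. 0 \<le> b n"
    and E: "abel_sum (\<lambda>n. psum a n powr q) (\<lambda>n. psum \<Omega> n powr (1 - q)) N \<le> K" and "0 < K"
    and G: "(\<Sum>i\<le>N. b i powr p * \<Omega> i) \<le> 1"
  shows "(\<Sum>i\<le>N. a i * b i) \<le> 2 * K powr (1 / q)"
proof -
  define t where "t = K powr (1 / p)"
  have t: "0 < t" "t powr p = K" using \<open>0 < K\<close> pq by (auto simp: t_def powr_powr)
  have "t * (\<Sum>i\<le>N. a i * b i) = (\<Sum>i\<le>N. a i * (t * b i))"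
    by (simp add: sum_distrib_left mult_ac)
  also have "\<dots> \<le> abel_sum (\<lambda>n. psum a n powr q) (\<lambda>n. psum \<Omega> n powr (1 - q)) N
      + (\<Sum>i\<le>N. (t * b i) powr p * \<Omega> i)"
    using b t by (intro sum_mult_le_abel_sum_add pq \<Omega> a) (auto simp: antimono_def)
  also have "(\<Sum>i\<le>N. (t * b i) powr p * \<Omega> i) = K * (\<Sum>i\<le>N. b i powr p * \<Omega> i)"
    using b t by (simp add: powr_mult sum_distrib_left mult.assoc)
  also have "\<dots> \<le> K * 1" using G \<open>0 < K\<close> by (intro mult_left_mono) auto
  finally have "t * (\<Sum>i\<le>N. a i * b i) \<le> 2 * K" using E by simp
  moreover have "K = t * K powr (1 / q)"
    unfolding t_def powr_add[symmetric] using pq \<open>0 < K\<close> by simp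
  ultimately have "t * (\<Sum>i\<le>N. a i * b i) \<le> t * (2 * K powr (1 / q))" by (simp add: mult_ac)
  then show ?thesis using t(1) by simp
qed

section \<open>The decreasing test sequence for the lower bound\<close>

text \<open>The left side is the mass of a plateau lying over the weight \<open>W - w\<close>; the
  right side is \<open>p\<close> times the lower bound of \<open>abel_sum_increment\<close> for the
  same stretch of indices.\<close>

lemma powr_level_inequality:
  fixes p q x y w W :: real
  assumes pq: "1 < p" "1 / p + 1 / q = 1" and "0 \<le> x" "x \<le> y" "0 < w" "w \<le> W"
  shows "y * W powr (1 - q) * (1 - w / W) \<le>
    p * ((y - x) * W powr (1 - q) + x * (w powr (1 - q) - W powr (1 - q)))"
proof -
  note q = conjugate_exponent[OF pq]
  define r where "r = w / W"
  have r: "0 < r" "r \<le> 1" using assms by (auto simp: r_def)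
  \<comment> \<open>Bernoulli's inequality through the logarithm. The factor \<open>p\<close> is
    chosen because \<open>p * (q - 1) = q\<close>, which is at least 1.\<close>
  have "1 + (1 - q) * ln r \<le> r powr (1 - q)"
    using r exp_ge_add_one_self[of "(1 - q) * ln r"] by (simp add: powr_def)
  moreover have "(q - 1) * (1 - r) \<le> (q - 1) * (- ln r)"
    using q ln_le_minus_one[of r] r by (intro mult_left_mono) auto
  ultimately have "(q - 1) * (1 - r) \<le> r powr (1 - q) - 1" by (simp add: algebra_simps)
  then have "p * ((q - 1) * (1 - r)) \<le> p * (r powr (1 - q) - 1)"
    using pq by (intro mult_left_mono) auto
  moreover have "1 - r \<le> p * ((q - 1) * (1 - r))"
    unfolding mult.assoc[symmetric] q(3) using mult_right_mono[of 1 q "1 - r"] q r by simp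
  ultimately have "1 - r \<le> p * (r powr (1 - q) - 1)" by linarith
  then have "x * (1 - r) \<le> x * (p * (r powr (1 - q) - 1))"
    using assms by (intro mult_left_mono) auto
  moreover have "(y - x) * (1 - r) \<le> (y - x) * p"
    using assms r by (intro mult_left_mono) auto
  ultimately have "y * (1 - r) \<le> p * ((y - x) + x * (r powr (1 - q) - 1))"
    by (simp add: algebra_simps)
  then have "W powr (1 - q) * (y * (1 - r)) \<le> W powr (1 - q) * (p * ((y - x) + x * (r powr (1 - q) - 1)))"
    by (rule mult_left_mono) simp
  moreover have "w powr (1 - q) = r powr (1 - q) * W powr (1 - q)"
    using assms by (simp add: r_def powr_divide)
  ultimately show ?thesis unfolding r_def[symmetric] by (simp add: algebra_simps)
qed

text \<open>The sequence constructed here is the least decreasing majorant of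
  \<open>n \<mapsto> (psum a n / psum \<Omega> n) powr (q - 1)\<close> on \<open>{..N}\<close>. Its last plateau ends at \<open>N\<close> and starts
  right after the last \<open>j < N\<close> at which the minorant exceeds its value at \<open>N\<close>.\<close>

lemma exists_decreasing_majorant:
  fixes p q :: real and a \<Omega> :: "nat \<Rightarrow> real"
  assumes pq: "1 < p" "1 / p + 1 / q = 1" and \<Omega>: "\<And>n. 0 \<le> \<Omega> n" "\<Omega> 0 \<noteq> 0" and a: "\<And>n. 0 \<le> a n"
  defines "u \<equiv> \<lambda>n. psum a n powr q" and "v \<equiv> \<lambda>n. psum \<Omega> n powr (1 - q)"
    and "\<phi> \<equiv> \<lambda>n. (psum a n / psum \<Omega> n) powr (q - 1)"
  shows "\<exists>h. antimono h \<and> (\<forall>i\<le>N. \<phi> i \<le> h i) \<and> (\<forall>i\<ge>N. h i = \<phi> N) \<and>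
    (\<Sum>i\<le>N. h i powr p * \<Omega> i) \<le> p * (2 * abel_sum u v N - u N * v N)"
proof (induction N rule: less_induct)
  case (less N)
  note q = conjugate_exponent[OF pq]
  have W: "0 < psum \<Omega> n" for n using \<Omega> by (rule psum_pos)
  have F: "0 \<le> psum a n" for n using a by (simp add: psum_def sum_nonneg)
  have u: "mono u" "\<And>n. 0 \<le> u n"
    using psum_mono[OF a] F q by (auto simp: u_def mono_def intro!: powr_mono2)
  have v: "antimono v" "\<And>n. 0 \<le> v n"
    using psum_mono[OF \<Omega>(1)] W q by (auto simp: v_def antimono_def intro!: powr_mono2')
  \<comment> \<open>A single plateau of height \<open>\<phi> N\<close> over all of
    \<open>{..N}\<close> has mass exactly \<open>u N * v N\<close>.\<close>
  have \<phi>_p: "\<phi> N powr p * psum \<Omega> N = u N * v N"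
  proof -
    have "\<phi> N powr p = (psum a N / psum \<Omega> N) powr q"
      unfolding \<phi>_def using q(3) by (simp add: powr_powr mult.commute)
    also have "\<dots> = u N * psum \<Omega> N powr (- q)"
      unfolding u_def using F[of N] W[of N] by (simp add: powr_divide powr_minus_divide)
    finally show ?thesis
      unfolding v_def using W[of N] powr_mult_base[of "psum \<Omega> N" "- q"] by (simp add: mult_ac)
  qed
  show ?case
  proof (cases "\<exists>j<N. \<phi> N < \<phi> j")
    case False
    have "0 \<le> u 0 * (v 0 - v N)" using u v by (simp add: antimono_def)
    then have ge: "u N * v N \<le> 2 * abel_sum u v N - u N * v N"
      using abel_sum_increment[OF u(1) v(1), of 0 N] by (simp add: algebra_simps)
    moreover have "0 \<le> u N * v N" using u v by simp
    ultimately have "0 \<le> 2 * abel_sum u v N - u N * v N" by linarith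
    then have "1 * (2 * abel_sum u v N - u N * v N) \<le> p * (2 * abel_sum u v N - u N * v N)"
      using pq by (intro mult_right_mono) auto
    then have "u N * v N \<le> p * (2 * abel_sum u v N - u N * v N)"
      unfolding mult_1 by (rule order_trans[OF ge])
    moreover have "(\<Sum>i\<le>N. \<phi> N powr p * \<Omega> i) = u N * v N"
      unfolding \<phi>_p[symmetric] by (simp add: psum_def sum_distrib_left)
    moreover have "\<phi> i \<le> \<phi> N" if "i \<le> N" for i
      using False that by (metis le_neq_implies_less not_less order_refl)
    ultimately show ?thesis
      by (intro exI[of _ "\<lambda>_. \<phi> N"]) (auto simp: antimono_def)
  next
    case True
    define j where "j = Max {j. j < N \<and> \<phi> N < \<phi> j}"
    have "j \<in> {j. j < N \<and> \<phi> N < \<phi> j}" unfolding j_def using True by (intro Max_in) auto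
    then have j: "j < N" "\<phi> N < \<phi> j" by auto
    have last: "\<phi> i \<le> \<phi> N" if "j < i" "i \<le> N" for i
    proof (rule ccontr)
      assume "\<not> \<phi> i \<le> \<phi> N"
      then have "i \<in> {j. j < N \<and> \<phi> N < \<phi> j}" using that by (cases "i = N") auto
      then have "i \<le> j" unfolding j_def by (intro Max_ge) auto
      then show False using that by simp
    qed
    \<comment> \<open>The majorant up to \<open>j\<close> ends at the value
      \<open>\<phi> j > \<phi> N\<close>, so appending a plateau of height \<open>\<phi> N\<close>
      keeps it decreasing.\<close>
    obtain h where h: "antimono h" "\<And>i. i \<le> j \<Longrightarrow> \<phi> i \<le> h i" "\<And>i. j \<le> i \<Longrightarrow> h i = \<phi> j"
      "(\<Sum>i\<le>j. h i powr p * \<Omega> i) \<le> p * (2 * abel_sum u v j - u j * v j)"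
      using less[OF j(1)] by blast
    define k where "k i = (if i \<le> j then h i else \<phi> N)" for i
    have "antimono k"
    proof (rule antimonoI)
      fix x y :: nat assume "x \<le> y"
      moreover have "\<phi> N \<le> h x" if "x \<le> j"
        using antimonoD[OF h(1) that] h(3)[of j] j by simp
      ultimately show "k y \<le> k x" using antimonoD[OF h(1), of x y] by (auto simp: k_def)
    qed
    moreover have "\<phi> i \<le> k i" if "i \<le> N" for i
      using that h(2) last by (auto simp: k_def)
    moreover have "k i = \<phi> N" if "N \<le> i" for i
      using that j by (simp add: k_def)
    moreover have "(\<Sum>i\<le>N. k i powr p * \<Omega> i) \<le> p * (2 * abel_sum u v N - u N * v N)"
    proof -
      have split: "{..N} = {..j} \<union> {j<..N}" "{..j} \<inter> {j<..N} = {}" using j by auto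
      have "(\<Sum>i\<le>N. k i powr p * \<Omega> i) = (\<Sum>i\<le>j. k i powr p * \<Omega> i) + (\<Sum>i\<in>{j<..N}. k i powr p * \<Omega> i)"
        unfolding split(1) using split(2) by (intro sum.union_disjoint) auto
      also have "(\<Sum>i\<le>j. k i powr p * \<Omega> i) = (\<Sum>i\<le>j. h i powr p * \<Omega> i)"
        by (simp add: k_def)
      also have "(\<Sum>i\<in>{j<..N}. k i powr p * \<Omega> i) = \<phi> N powr p * (psum \<Omega> N - psum \<Omega> j)"
      proof -
        have "psum \<Omega> N = psum \<Omega> j + (\<Sum>i\<in>{j<..N}. \<Omega> i)"
          unfolding psum_def split(1) using split(2) by (intro sum.union_disjoint) auto
        then show ?thesis by (simp add: k_def sum_distrib_left)
      qed
      also have "\<dots> = (\<phi> N powr p * psum \<Omega> N) * (1 - psum \<Omega> j / psum \<Omega> N)"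
        using W[of N] by (simp add: field_simps)
      also have "\<dots> = u N * psum \<Omega> N powr (1 - q) * (1 - psum \<Omega> j / psum \<Omega> N)"
        unfolding \<phi>_p v_def ..
      also have "\<dots> \<le> p * ((u N - u j) * psum \<Omega> N powr (1 - q) + u j * (psum \<Omega> j powr (1 - q) - psum \<Omega> N powr (1 - q)))"
        using u j W psum_mono[OF \<Omega>(1), of j N] monoD[OF u(1), of j N]
        by (intro powr_level_inequality pq) auto
      also have "\<dots> = p * ((u N - u j) * v N + u j * (v j - v N))" by (simp add: v_def)
      also have "\<dots> \<le> p * ((2 * abel_sum u v N - u N * v N) - (2 * abel_sum u v j - u j * v j))"
        using abel_sum_increment[OF u(1) v(1), of j N] j pq by (intro mult_left_mono) auto
      finally show ?thesis using h(4) by (simp add: algebra_simps)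
    qed
    ultimately show ?thesis by blast
  qed
qed

text \<open>Pairing \<open>a\<close> with the pointwise optimiser recovers the Abel sum up to
  \<open>q\<close>; replacing the optimiser by a majorant only enlarges the pairing.\<close>

lemma abel_sum_le_sum_mult:
  fixes q :: real and a \<Omega> :: "nat \<Rightarrow> real"
  assumes q: "1 \<le> q" and a: "\<And>n. 0 \<le> a n" and \<Omega>: "\<And>n. 0 \<le> \<Omega> n"
  shows "abel_sum (\<lambda>n. psum a n powr q) (\<lambda>n. psum \<Omega> n powr (1 - q)) N
    \<le> q * (\<Sum>i\<le>N. a i * (psum a i / psum \<Omega> i) powr (q - 1))"
proof -
  have F: "0 \<le> psum a n" and W: "0 \<le> psum \<Omega> n" for n
    using a \<Omega> by (simp_all add: psum_def sum_nonneg)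
  have \<phi>: "(psum a i / psum \<Omega> i) powr (q - 1) = psum a i powr (q - 1) * psum \<Omega> i powr (1 - q)" for i
    using F[of i] W[of i] powr_minus[of "psum \<Omega> i" "q - 1"] by (simp add: powr_divide field_simps)
  show ?thesis
    unfolding \<phi>
  proof (induction N)
    case 0
    have "a 0 powr q * \<Omega> 0 powr (1 - q) \<le> q * (a 0 powr q * \<Omega> 0 powr (1 - q))"
      using q mult_right_mono[of 1 q "a 0 powr q * \<Omega> 0 powr (1 - q)"] by simp
    moreover have "a 0 * a 0 powr (q - 1) = a 0 powr q"
      using powr_minus_one_mult[of "a 0" q] a[of 0] by (simp add: mult.commute)
    ultimately show ?case by (simp flip: mult.assoc)
  next
    case (Suc N)
    have "psum a (Suc N) powr q - psum a N powr q
        \<le> q * psum a (Suc N) powr (q - 1) * (psum a (Suc N) - psum a N)"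
      using q F[of N] a[of "Suc N"] by (intro powr_diff_upper) auto
    then have "(psum a (Suc N) powr q - psum a N powr q) * psum \<Omega> (Suc N) powr (1 - q)
        \<le> (q * psum a (Suc N) powr (q - 1) * a (Suc N)) * psum \<Omega> (Suc N) powr (1 - q)"
      by (intro mult_right_mono) auto
    then show ?case using Suc by (simp add: algebra_simps)
  qed
qed

section \<open>Exponents greater than one\<close>

text \<open>The factor \<open>(n + 1)^q\<close> of the dual weight cancels the denominator of the
  Hardy average.\<close>

lemma hardy_term_eq_dual_term:
  assumes q: "1 < q" and \<Omega>: "\<And>n. 0 \<le> \<Omega> n" "\<Omega> 0 \<noteq> 0"
    and f: "\<And>n. rearr f n = ennreal (a n)" and a: "\<And>n. 0 \<le> a n"
  shows "(hardy_d (rearr f) n epowr q) * ennreal (dual_weight \<Omega> q n)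
    = ennreal (dual_term (\<lambda>n. psum a n powr q) (\<lambda>n. psum \<Omega> n powr (1 - q)) n)"
proof -
  have F: "0 \<le> psum a n" using a by (simp add: psum_def sum_nonneg)
  have "hardy_d (rearr f) n = ennreal (psum a n) / ennreal (real (n + 1))"
    unfolding hardy_d_def ennreal_of_nat_eq_real_of_nat using f a by (simp add: psum_def)
  also have "\<dots> = ennreal (psum a n / real (n + 1))"
    using F by (intro divide_ennreal) auto
  finally have "hardy_d (rearr f) n epowr q = ennreal ((psum a n / real (n + 1)) powr q)"
    using F by (simp add: ennreal_powr_ennreal)
  moreover have "0 \<le> dual_weight \<Omega> q n"
    using psum_mono[OF \<Omega>(1), of "n - 1" n] psum_pos[of \<Omega> "n - 1", OF \<Omega>] q
    by (auto simp: dual_weight_def intro!: mult_nonneg_nonneg powr_mono2')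
  moreover have "(psum a n / real (n + 1)) powr q * dual_weight \<Omega> q n
      = dual_term (\<lambda>n. psum a n powr q) (\<lambda>n. psum \<Omega> n powr (1 - q)) n"
    using F by (cases n) (auto simp: dual_weight_def dual_term_def powr_divide)
  ultimately show ?thesis by (simp add: ennreal_mult[symmetric])
qed

lemma filterlim_psum_at_top:
  assumes "\<And>n. 0 \<le> \<Omega> n" "\<not> summable \<Omega>"
  shows "filterlim (psum \<Omega>) at_top sequentially"
  unfolding filterlim_at_top
proof
  fix Z :: real
  obtain n where "Z \<le> psum \<Omega> n"
    using bounded_imp_summable[of \<Omega> Z] assms unfolding psum_def by (meson le_cases)
  then show "eventually (\<lambda>m. Z \<le> psum \<Omega> m) sequentially"
    using psum_mono[of \<Omega> n, OF assms(1)] by (auto simp: eventually_sequentially intro: order_trans)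
qed

text \<open>The constant \<open>1 / 2\<close> inverts the factor of
  \<open>sum_mult_le_two_mult_powr\<close>, applied with the dual sum \<open>D\<close> as
  \<open>K\<close>.\<close>

lemma assoc_d_norm_le_hardy:
  assumes pq: "1 < p" "1 / p + 1 / q = 1" and \<Omega>: "\<And>n. 0 \<le> \<Omega> n" "\<Omega> 0 \<noteq> 0" "\<not> summable \<Omega>"
  shows "ennreal (1 / 2) * assoc_norm (d_norm \<Omega> p) f
    \<le> (\<Sum>n. (hardy_d (rearr f) n epowr q) * ennreal (dual_weight \<Omega> q n)) epowr (1 / q)"
    (is "_ \<le> ?D epowr _")
proof (cases ?D)
  case (real D)
  note q = conjugate_exponent[OF pq]
  define v where "v n = psum \<Omega> n powr (1 - q)" for n
  have W: "0 < psum \<Omega> n" for n using \<Omega>(1,2) by (rule psum_pos)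
  have v: "antimono v" "\<And>n. 0 \<le> v n"
    using psum_mono[OF \<Omega>(1)] W q by (auto simp: v_def antimono_def intro!: powr_mono2')
  have "rearr f 0 \<noteq> top"
  proof
    assume "rearr f 0 = top"
    then have "hardy_d (rearr f) 0 = top"
      by (simp add: hardy_d_def divide_ennreal_def ennreal_top_mult)
    then have "(hardy_d (rearr f) 0 epowr q) * ennreal (dual_weight \<Omega> q 0) = top"
      using W[of 0] by (simp add: dual_weight_def ennreal_powr_def ennreal_top_mult)
    then have "?D = top"
      using sum_le_suminf[of "\<lambda>n. (hardy_d (rearr f) n epowr q) * ennreal (dual_weight \<Omega> q n)" "{0}"]
      by (simp add: top_unique)
    then show False unfolding real(2) by simp
  qed
  then obtain a where a: "\<And>n. rearr f n = ennreal (a n)" "antimono a" "\<And>n. 0 \<le> a n"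
    by (rule rearr_real) blast
  define u where "u n = psum a n powr q" for n
  have F: "0 \<le> psum a n" for n using a by (simp add: psum_def sum_nonneg)
  have u: "mono u" "\<And>n. 0 \<le> u n"
    using psum_mono[OF a(3)] F q by (auto simp: u_def mono_def intro!: powr_mono2)
  have D: "(\<Sum>n. ennreal (dual_term u v n)) \<le> ennreal D"
    using real(2) hardy_term_eq_dual_term[of q \<Omega> f a, OF q(1) \<Omega>(1,2) a(1,3)] unfolding u_def v_def by simp
  have "filterlim (psum \<Omega>) at_top sequentially"
    using \<Omega>(1,3) by (rule filterlim_psum_at_top)
  then have "(\<lambda>n. v n) \<longlonglongrightarrow> 0"
    unfolding v_def using q by (intro tendsto_neg_powr) auto
  \<comment> \<open>Here the divergence of \<open>\<Sum> \<Omega>\<close> removes the boundary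
    term.\<close>
  then have lim: "(\<lambda>M. abel_sum u v N - u N * v M) \<longlonglongrightarrow> abel_sum u v N - u N * 0" for N
    by (intro tendsto_intros)
  have E: "abel_sum u v N \<le> D" for N
  proof -
    have "abel_sum u v N - u N * v M \<le> D" if "N \<le> M" for M
    proof -
      have "abel_sum u v N - u N * v M \<le> (\<Sum>n\<le>M. dual_term u v n)"
        using that by (rule abel_sum_le_dual_sum[OF u v])
      also have "\<dots> \<le> D"
        using D real(1) dual_term_nonneg[OF v(1) u(2) v(2)] by (intro sum_le_of_ennreal_suminf_le)
      finally show ?thesis .
    qed
    then show ?thesis using LIMSEQ_le_const2[OF lim[of N], of D] by auto
  qed
  have "assoc_norm (d_norm \<Omega> p) f \<le> ennreal (2 * D powr (1 / q))"
  proof (rule assoc_norm_le[OF a(1,3)])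
    fix g assume "d_norm \<Omega> p g \<le> 1"
    then obtain b where b: "\<And>n. rearr g n = ennreal (b n)" "antimono b" "\<And>n. 0 \<le> b n"
      "\<And>n. (\<Sum>i\<le>n. b i powr p * \<Omega> i) \<le> 1"
      using d_norm_le_oneD[of p \<Omega> g] \<Omega> pq by auto
    have "(\<Sum>i\<le>n. a i * b i) \<le> 2 * D powr (1 / q)" for n
    \<comment> \<open>The rescaling needs \<open>D > 0\<close>. If \<open>D = 0\<close>, the first
      Abel term forces \<open>a 0 = 0\<close>, and \<open>a\<close> vanishes by
      monotonicity.\<close>
    proof (cases "D = 0")
      case True
      then have "u 0 * v 0 \<le> 0" using E[of 0] by simp
      then have "a 0 = 0" using W[of 0] a(3)[of 0] by (simp add: u_def v_def mult_le_0_iff)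
      then have "a i = 0" for i using antimonoD[OF a(2), of 0 i] a(3)[of i] by simp
      then show ?thesis by simp
    next
      case False
      then show ?thesis
        using E real(1) unfolding u_def v_def
        by (intro sum_mult_le_two_mult_powr[where p = p and \<Omega> = \<Omega>] pq \<Omega> a b) auto
    qed
    then show "\<exists>b. (\<forall>n. rearr g n = ennreal (b n)) \<and> (\<forall>n. 0 \<le> b n) \<and>
        (\<forall>n. (\<Sum>i\<le>n. a i * b i) \<le> 2 * D powr (1 / q))"
      using b by blast
  qed
  then have "ennreal (1 / 2) * assoc_norm (d_norm \<Omega> p) f \<le> ennreal (1 / 2) * ennreal (2 * D powr (1 / q))"
    by (rule mult_left_mono) simp
  also have "\<dots> = ennreal (1 / 2 * (2 * D powr (1 / q)))"
    by (rule ennreal_mult[symmetric]) simp_all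
  also have "\<dots> = ?D epowr (1 / q)"
    unfolding real(2) using real(1) by (simp add: ennreal_powr_ennreal)
  finally show ?thesis .
qed (simp add: ennreal_powr_def)

lemma abel_sum_powr_le_assoc_norm:
  fixes p q :: real and N :: nat
  assumes pq: "1 < p" "1 / p + 1 / q = 1" and \<Omega>: "\<And>n. 0 \<le> \<Omega> n" "\<Omega> 0 \<noteq> 0"
    and f: "\<And>n. rearr f n = ennreal (a n)" and a: "\<And>n. 0 \<le> a n"
  defines "E \<equiv> abel_sum (\<lambda>n. psum a n powr q) (\<lambda>n. psum \<Omega> n powr (1 - q)) N"
  shows "ennreal (E powr (1 / q) / (q * (2 * p) powr (1 / p))) \<le> assoc_norm (d_norm \<Omega> p) f"
proof (cases "E \<le> 0")
  \<comment> \<open>No normalisation is possible here, but then \<open>E = 0\<close> and the left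
    side is 0.\<close>
  case True
  have "0 \<le> E"
    unfolding E_def using psum_mono[OF a] psum_mono[OF \<Omega>(1)] conjugate_exponent(1)[OF pq] a
    by (intro abel_sum_nonneg) (auto simp: mono_def psum_def sum_nonneg intro!: powr_mono2)
  then show ?thesis using True by simp
next
  case False
  note q = conjugate_exponent[OF pq]
  have W: "0 < psum \<Omega> n" for n using \<Omega> by (rule psum_pos)
  obtain h where h: "antimono h" "\<And>i. i \<le> N \<Longrightarrow> (psum a i / psum \<Omega> i) powr (q - 1) \<le> h i"
      "(\<Sum>i\<le>N. h i powr p * \<Omega> i) \<le> p * (2 * E - psum a N powr q * psum \<Omega> N powr (1 - q))"
    using exists_decreasing_majorant[of p q \<Omega> a, OF pq \<Omega> a, of N] unfolding E_def by blast
  have h0: "0 \<le> h i" if "i \<le> N" for i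
    using h(2)[OF that] by (rule order_trans[rotated]) simp
  \<comment> \<open>The majorant has mass at most \<open>2 * p * E\<close>, so this factor puts it
    into the unit ball. Its pairing with \<open>f*\<close> is then at least
    \<open>c * (E / q)\<close>, and \<open>1 - 1 / p = 1 / q\<close> gives the stated power of
    \<open>E\<close>.\<close>
  define c where "c = (2 * p * E) powr (- 1 / p)"
  define k where "k i = (if i \<le> N then c * h i else 0)" for i
  have pE: "0 < 2 * p * E" using False pq by simp
  have c: "0 < c" "c powr p = 1 / (2 * p * E)"
    using pE pq False by (simp_all add: c_def powr_powr powr_neg_one)
  have "(\<Sum>i\<le>N. k i powr p * \<Omega> i) = c powr p * (\<Sum>i\<le>N. h i powr p * \<Omega> i)"
    unfolding sum_distrib_left using h0 c by (intro sum.cong) (auto simp: k_def powr_mult)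
  also have "\<dots> \<le> c powr p * (2 * p * E)"
  proof (rule mult_left_mono)
    have "p * (2 * E - psum a N powr q * psum \<Omega> N powr (1 - q)) \<le> p * (2 * E)"
      using pq by (intro mult_left_mono) auto
    then show "(\<Sum>i\<le>N. h i powr p * \<Omega> i) \<le> 2 * p * E" using h(3) by simp
  qed simp
  also have "\<dots> = 1" using c(2) pq False by simp
  finally have norm: "(\<Sum>i\<le>N. k i powr p * \<Omega> i) \<le> 1" .
  have k: "antimono k" "\<And>i. 0 \<le> k i" "\<And>i. N < i \<Longrightarrow> k i = 0"
    using h0 c antimonoD[OF h(1)] by (auto simp: k_def antimono_def)
  have "E powr (1 / q) / (q * (2 * p) powr (1 / p)) = c * (E / q)"
  proof -
    have "1 / q = 1 + - 1 / p" using pq by simp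
    then have "E powr (1 / q) = E powr (1 + - 1 / p)" by simp
    also have "\<dots> = E * E powr (- 1 / p)" using False unfolding powr_add by simp
    finally have "E powr (1 / q) = E * E powr (- 1 / p)" .
    moreover have "c = (2 * p) powr (- 1 / p) * E powr (- 1 / p)"
      unfolding c_def by (rule powr_mult)
    ultimately show ?thesis
      using pq by (simp add: powr_minus field_simps)
  qed
  also have "\<dots> \<le> c * (\<Sum>i\<le>N. a i * (psum a i / psum \<Omega> i) powr (q - 1))"
    using abel_sum_le_sum_mult[of q a \<Omega> N] q a \<Omega> c unfolding E_def[symmetric]
    by (intro mult_left_mono) (auto simp: divide_le_eq mult.commute)
  also have "\<dots> \<le> c * (\<Sum>i\<le>N. a i * h i)"
    using h(2) a c by (intro mult_left_mono sum_mono) auto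
  also have "\<dots> = (\<Sum>i\<le>N. a i * k i)"
    by (simp add: k_def sum_distrib_left mult_ac)
  finally have "ennreal (E powr (1 / q) / (q * (2 * p) powr (1 / p))) \<le> ennreal (\<Sum>i\<le>N. a i * k i)"
    by (rule ennreal_leI)
  also have "\<dots> = (\<Sum>i\<le>N. rearr f i * ennreal (k i))"
    using a k f by (simp add: ennreal_mult[symmetric])
  also have "\<dots> \<le> assoc_norm (d_norm \<Omega> p) f"
    using pq by (intro le_assoc_norm k d_norm_le_one[where h = k and n = N] \<Omega> norm) auto
  finally show ?thesis .
qed

text \<open>The constant combines the loss from the test sequence with
  \<open>(1 + 2 powr q) powr (1 / q)\<close>, the cost of passing from the dual sum to the Abel
  sum.\<close>

lemma hardy_le_assoc_d_norm:
  assumes pq: "1 < p" "1 / p + 1 / q = 1" and \<Omega>: "\<And>n. 0 \<le> \<Omega> n" "\<Omega> 0 \<noteq> 0"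
  shows "(\<Sum>n. (hardy_d (rearr f) n epowr q) * ennreal (dual_weight \<Omega> q n)) epowr (1 / q)
    \<le> ennreal ((1 + 2 powr q) powr (1 / q) * (q * (2 * p) powr (1 / p))) * assoc_norm (d_norm \<Omega> p) f"
proof -
  note q = conjugate_exponent[OF pq]
  define c where "c = q * (2 * p) powr (1 / p)"
  define C where "C = (1 + 2 powr q) powr (1 / q)"
  have c: "0 < c" using pq q by (simp add: c_def)
  have "0 < 1 + 2 powr q" by (rule add_pos_pos) auto
  then have C: "0 < C" by (simp add: C_def)
  show ?thesis
    unfolding c_def[symmetric] C_def[symmetric]
  proof (cases "assoc_norm (d_norm \<Omega> p) f")
    case (real L)
    have "rearr f 0 \<noteq> top" using assoc_d_norm_eq_top[of p \<Omega> f] \<Omega> pq real by auto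
    then obtain a where a: "\<And>n. rearr f n = ennreal (a n)" "antimono a" "\<And>n. 0 \<le> a n"
      by (rule rearr_real) blast
    define u where "u n = psum a n powr q" for n
    define v where "v n = psum \<Omega> n powr (1 - q)" for n
    have W: "0 < psum \<Omega> n" for n using \<Omega> by (rule psum_pos)
    have F: "0 \<le> psum a n" for n using a by (simp add: psum_def sum_nonneg)
    have v: "antimono v" "\<And>n. 0 \<le> v n"
      using psum_mono[OF \<Omega>(1)] W q by (auto simp: v_def antimono_def intro!: powr_mono2')
    have u: "mono u" "\<And>n. 0 \<le> u n"
      using psum_mono[OF a(3)] F q by (auto simp: u_def mono_def intro!: powr_mono2)
    have doubling: "u (Suc n) \<le> 2 powr q * u n" for n
    proof -
      \<comment> \<open>Monotonicity of \<open>f*\<close> bounds the new entry by the first one,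
        hence by the sum so far.\<close>
      have "a (Suc n) \<le> a 0" using antimonoD[OF a(2), of 0 "Suc n"] by simp
      also have "\<dots> \<le> psum a n" using psum_mono[OF a(3), of 0 n] by simp
      finally have "psum a (Suc n) \<le> 2 * psum a n" by simp
      then have "psum a (Suc n) powr q \<le> (2 * psum a n) powr q"
        using q F[of "Suc n"] by (intro powr_mono2) simp_all
      then show ?thesis using F[of n] by (simp add: u_def powr_mult)
    qed
    have E: "abel_sum u v N \<le> (c * L) powr q" for N
    proof -
      have "0 \<le> abel_sum u v N" using u v by (intro abel_sum_nonneg) auto
      have "ennreal (abel_sum u v N powr (1 / q) / c) \<le> ennreal L"
        unfolding real(2)[symmetric] c_def u_def v_def
        by (rule abel_sum_powr_le_assoc_norm[where \<Omega> = \<Omega> and f = f and a = a, OF pq \<Omega> a(1,3)])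
      then have "abel_sum u v N powr (1 / q) \<le> c * L"
        using real(1) c by (simp add: ennreal_le_iff divide_le_eq mult.commute)
      then have "(abel_sum u v N powr (1 / q)) powr q \<le> (c * L) powr q"
        using q by (intro powr_mono2) auto
      then show ?thesis using q \<open>0 \<le> abel_sum u v N\<close> by (simp add: powr_powr)
    qed
    have "(\<Sum>n<N. dual_term u v n) \<le> (1 + 2 powr q) * (c * L) powr q" for N
    proof -
      have "(\<Sum>n<N. dual_term u v n) \<le> (\<Sum>n\<le>N. dual_term u v n)"
        using dual_term_nonneg[OF v(1) u(2) v(2)] by (intro sum_mono2) auto
      also have "\<dots> \<le> (1 + 2 powr q) * abel_sum u v N"
        using doubling by (intro dual_sum_le_abel_sum u v) auto
      also have "\<dots> \<le> (1 + 2 powr q) * (c * L) powr q"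
        using E[of N] by (intro mult_left_mono) auto
      finally show ?thesis .
    qed
    then have "(\<Sum>n. ennreal (dual_term u v n)) \<le> ennreal ((1 + 2 powr q) * (c * L) powr q)"
      using dual_term_nonneg[OF v(1) u(2) v(2)] by (intro ennreal_suminf_le)
    then have "(\<Sum>n. ennreal (dual_term u v n)) epowr (1 / q)
        \<le> ennreal ((1 + 2 powr q) * (c * L) powr q) epowr (1 / q)"
      using q by (intro ennreal_powr_mono) auto
    also have "\<dots> = ennreal (C * c * L)"
      using q c real(1) by (simp add: ennreal_powr_ennreal powr_mult powr_powr C_def)
    also have "\<dots> = ennreal (C * c) * assoc_norm (d_norm \<Omega> p) f"
      using real c C by (simp add: ennreal_mult[symmetric])
    finally show "(\<Sum>n. (hardy_d (rearr f) n epowr q) * ennreal (dual_weight \<Omega> q n)) epowr (1 / q)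
        \<le> ennreal (C * c) * assoc_norm (d_norm \<Omega> p) f"
      using hardy_term_eq_dual_term[of q \<Omega> f a, OF q(1) \<Omega>(1,2) a(1,3)] unfolding u_def v_def by simp
  next
    case top
    then show "(\<Sum>n. (hardy_d (rearr f) n epowr q) * ennreal (dual_weight \<Omega> q n)) epowr (1 / q)
        \<le> ennreal (C * c) * assoc_norm (d_norm \<Omega> p) f"
      using c C by (simp add: ennreal_mult_top)
  qed
qed

theorem theorem2p4p14:
  shows "(\<forall>(p::real) (\<Omega>::nat \<Rightarrow> real) (f::nat \<Rightarrow> complex).
            0 < p \<and> p \<le> 1 \<and> (\<forall>n. 0 \<le> \<Omega> n) \<and> \<Omega> 0 \<noteq> 0 \<longrightarrow>
              assoc_norm (d_norm \<Omega> p) f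
                = (SUP n. ennreal (psum \<Omega> n powr (- 1 / p)) * (\<Sum>k\<le>n. rearr f k)))
       \<and> (\<forall>(p::real) (q::real). 1 < p \<and> 1 / p + 1 / q = 1 \<longrightarrow>
            (\<exists>C1>0. \<exists>C2>0. \<forall>(\<Omega>::nat \<Rightarrow> real) (f::nat \<Rightarrow> complex).
              (\<forall>n. 0 \<le> \<Omega> n) \<and> \<Omega> 0 \<noteq> 0 \<and> \<not> summable \<Omega> \<longrightarrow>
                ennreal C1 * assoc_norm (d_norm \<Omega> p) f
                  \<le> (\<Sum>n. (hardy_d (rearr f) n epowr q) * ennreal (dual_weight \<Omega> q n)) epowr (1 / q)
                \<and> (\<Sum>n. (hardy_d (rearr f) n epowr q) * ennreal (dual_weight \<Omega> q n)) epowr (1 / q)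
                  \<le> ennreal C2 * assoc_norm (d_norm \<Omega> p) f))
       \<and> (\<forall>(p::real) (\<Omega>::nat \<Rightarrow> real) (f::nat \<Rightarrow> complex).
            0 < p \<and> (\<forall>n. 0 \<le> \<Omega> n) \<and> \<Omega> 0 \<noteq> 0 \<longrightarrow>
              assoc_norm (dinf_norm \<Omega> p) f
                = (\<Sum>n. rearr f n * ennreal (psum \<Omega> n powr (- 1 / p)))
              \<and> (\<Sum>n. rearr f n * ennreal (psum \<Omega> n powr (- 1 / p)))
                = d_norm (\<lambda>n. psum \<Omega> n powr (- 1 / p)) 1 f)"
proof (intro conjI allI impI)
  fix p q :: real
  assume pq: "1 < p \<and> 1 / p + 1 / q = 1"
  \<comment> \<open>Both constants are fixed before \<open>\<Omega>\<close> and \<open>f\<close>;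
    they involve only \<open>p\<close> and \<open>q\<close>, and \<open>p\<close> determines
    \<open>q\<close>.\<close>
  have "0 < 1 + 2 powr q" by (rule add_pos_pos) auto
  then have "0 < (1 + 2 powr q) powr (1 / q) * (q * (2 * p) powr (1 / p))"
    using pq conjugate_exponent(1)[of p q] by simp
  then show "\<exists>C1>0. \<exists>C2>0. \<forall>(\<Omega>::nat \<Rightarrow> real) (f::nat \<Rightarrow> complex).
      (\<forall>n. 0 \<le> \<Omega> n) \<and> \<Omega> 0 \<noteq> 0 \<and> \<not> summable \<Omega> \<longrightarrow>
        ennreal C1 * assoc_norm (d_norm \<Omega> p) f
          \<le> (\<Sum>n. (hardy_d (rearr f) n epowr q) * ennreal (dual_weight \<Omega> q n)) epowr (1 / q)
        \<and> (\<Sum>n. (hardy_d (rearr f) n epowr q) * ennreal (dual_weight \<Omega> q n)) epowr (1 / q)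
          \<le> ennreal C2 * assoc_norm (d_norm \<Omega> p) f"
    using pq assoc_d_norm_le_hardy hardy_le_assoc_d_norm
    by (intro exI[of _ "1 / 2"] exI[of _ "(1 + 2 powr q) powr (1 / q) * (q * (2 * p) powr (1 / p))"]
        conjI allI impI) auto
qed (auto simp: assoc_d_norm_p_le_1 assoc_dinf_norm d_norm_exponent_1)

end
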